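(* Let $\alpha>1$, $c=1/\alpha$, $L>0$, and let $T$ be a matrix indexed by $\mathbb{Z}^b\times\mathbb{Z}^d$ satisfying $$|T(x,x')|<e^{-L|x-x'|_\alpha},\qquad x\ne x'.$$ Let $M_0,M_1\in\mathbb{Z}_+$ ($M_0$ sufficiently large) with $(\log M_0)^{\iota'}\le\log\log M_1\le\iota\log M_0$, where $\iota<c$ and $\iota'>0$ is a small constant. Let $Q_0=[-M_0,M_0]^d$ and $\Omega=[-M_1,M_1]^b\times Q$, where $Q$ is an $M_1$-interval in $\mathbb{Z}^d$. Assume there is a decomposition $\Omega=\Omega_0\cup\Omega_1$ such that: (i) For every $x=(k,n)\in\Omega_0$, setting $V_x=(k+[-M_0,M_0]^b)\times(n+Q_0)$, $$\|G_{V_x}\|\le e^{M_0^\kappa},\qquad |G_{V_x}(\eta,\eta')|<e^{-L|\eta-\eta'|_\alpha}\ \text{ for } |\eta-\eta'|>M_0^\theta,$$ where $\kappa<c$ and $0<\theta<1$. (ii) $\Omega_1=\bigcup_\beta\Omega_{1,\beta}$ with $\mathrm{diam}\,\Omega_{1,\beta}<M_1^{\theta_1}$ and $\mathrm{dist}(\Omega_{1,\beta},\Omega_{1,\beta'})>M_1^{\theta_2}$ for $\beta\ne\beta'$. (iii) The $M_1^{\theta_3}$-neighborhood $\widetilde\Omega_{1,\beta}$ of $\Omega_{1,\beta}$ satisfies $\|G_{\widetilde\Omega_{1,\beta}}\|<e^{M_1^{\theta_4}}$. Here $0<\theta_4<\theta_3<\theta_2<\theta_1<\theta<1$. Assume furthermore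 $c>\frac{\theta_4}{\theta_3}$ and $c<\frac{\theta-\theta_1-\tilde\delta}{1-\theta_3}$ for some small constant $\tilde\delta>0$. Then $$\|G_\Omega\|<e^{M_1^{\theta_4+}},\qquad |G_\Omega(x,y)|<e^{-\left(L-2M_0^{\max\{\iota,\kappa,\theta c\}-c}\right)|x-y|_\alpha}\ \text{ for } |x-y|>M_1^\theta .$$
   Context: For a finite subset $\Lambda$ of the index set, $T_\Lambda$ is the restriction of $T$ to $\Lambda\times\Lambda$, and $G_\Lambda:=T_\Lambda^{-1}$; a bound on $G_\Lambda$ includes the assertion that $T_\Lambda$ is invertible. $\|\cdot\|$ is the $\ell^2$ operator norm. For $x\in\mathbb{Z}^{b+d}$, $|x|=\max_i|x_i|$ and $|x|_\alpha=\sum_i|x_i|^{1/\alpha}$; distances, diameters and neighborhoods are with respect to $|\cdot|$. An $M$-interval is a cube of side length $M$ with sides parallel to the axes, and boxes such as $[-M,M]^b$ denote their sets of integer points. $M_1^{\theta_4+}$ means $M_1^{\theta_4+\epsilon}$ for a small $\epsilon>0$. "Sufficiently large" means larger than a threshold depending on the fixed constants $b,d,\alpha,L,\iota,\iota',\kappa,\theta,\theta_1,\dots,\theta_4,\tilde\delta$.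
   Formalization: The M_1^{θ_3}-neighborhood of Ω_{1,β} in (iii) is taken inside Ω (points of Ω within that distance); with neighborhoods in the full lattice the claim fails, since T_Ω can be singular when a site on a face of Ω couples only to a site just outside Ω. *)

theory Defs
  imports "HOL-Analysis.Analysis"
begin

type_synonym ('b, 'd) site = "(int ^ 'b) \<times> (int ^ 'd)"

definition max_norm :: "('b::finite, 'd::finite) site \<Rightarrow> real" where
  "max_norm x = real_of_int
     (Max (range (\<lambda>i. \<bar>fst x $ i\<bar>) \<union> range (\<lambda>j. \<bar>snd x $ j\<bar>)))"

definition alpha_norm :: "real \<Rightarrow> ('b::finite, 'd::finite) site \<Rightarrow> real" where
  "alpha_norm \<alpha> x =
     (\<Sum>i\<in>UNIV. \<bar>real_of_int (fst x $ i)\<bar> powr (1 / \<alpha>)) +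
     (\<Sum>j\<in>UNIV. \<bar>real_of_int (snd x $ j)\<bar> powr (1 / \<alpha>))"

text \<open>Diameter and distance are extended reals, so that the empty set has diameter
  \<open>-\<infinity>\<close> and is at distance \<open>\<infinity>\<close> from every set.\<close>

definition set_diam :: "('b::finite, 'd::finite) site set \<Rightarrow> ereal" where
  "set_diam A = (SUP (x, y)\<in>A \<times> A. ereal (max_norm (x - y)))"

definition set_dist ::
    "('b::finite, 'd::finite) site set \<Rightarrow> ('b, 'd) site set \<Rightarrow> ereal" where
  "set_dist A B = (INF (x, y)\<in>A \<times> B. ereal (max_norm (x - y)))"

text \<open>Neighbourhoods are taken inside the region \<open>\<Omega>\<close>: invertibility of \<open>T\<close> on a set that
  sticks out of \<open>\<Omega>\<close> gives no control of \<open>T\<close> restricted to \<open>\<Omega>\<close> near the boundary.\<close>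

definition nbhd_in ::
    "('b::finite, 'd::finite) site set \<Rightarrow> real \<Rightarrow> ('b, 'd) site set \<Rightarrow> ('b, 'd) site set" where
  "nbhd_in \<Omega> r A = {x \<in> \<Omega>. \<exists>y\<in>A. max_norm (x - y) \<le> r}"

definition int_box :: "nat \<Rightarrow> (int ^ 'n::finite) set" where
  "int_box M = {k. \<forall>i. - int M \<le> k $ i \<and> k $ i \<le> int M}"

text \<open>The corner of the cube is a real point, so that a cube of side \<open>M\<close> may contain
  \<open>M\<close> or \<open>M + 1\<close> integers in each coordinate direction.\<close>

definition cube_interval :: "nat \<Rightarrow> (int ^ 'n::finite) set \<Rightarrow> bool" where
  "cube_interval M Q \<longleftrightarrow> (\<exists>a :: real ^ 'n.
     Q = {n. \<forall>i. a $ i \<le> real_of_int (n $ i) \<and> real_of_int (n $ i) \<le> a $ i + real M})"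

definition window :: "nat \<Rightarrow> ('b::finite, 'd::finite) site \<Rightarrow> ('b, 'd) site set" where
  "window M x = ((+) (fst x) ` int_box M) \<times> ((+) (snd x) ` int_box M)"

text \<open>A matrix over \<open>\<Lambda>\<close> is represented by its values on \<open>\<Lambda> \<times> \<Lambda>\<close>; an inverse is
  normalised to vanish off \<open>\<Lambda> \<times> \<Lambda>\<close>, which makes it unique for finite \<open>\<Lambda>\<close>.\<close>

definition inverse_on ::
    "'a set \<Rightarrow> ('a \<Rightarrow> 'a \<Rightarrow> complex) \<Rightarrow> ('a \<Rightarrow> 'a \<Rightarrow> complex) \<Rightarrow> bool" where
  "inverse_on \<Lambda> T G \<longleftrightarrow>
     (\<forall>x\<in>\<Lambda>. \<forall>y\<in>\<Lambda>. (\<Sum>z\<in>\<Lambda>. T x z * G z y) = (if x = y then 1 else 0)) \<and>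
     (\<forall>x\<in>\<Lambda>. \<forall>y\<in>\<Lambda>. (\<Sum>z\<in>\<Lambda>. G x z * T z y) = (if x = y then 1 else 0)) \<and>
     (\<forall>x y. x \<notin> \<Lambda> \<or> y \<notin> \<Lambda> \<longrightarrow> G x y = 0)"

definition invertible_on :: "'a set \<Rightarrow> ('a \<Rightarrow> 'a \<Rightarrow> complex) \<Rightarrow> bool" where
  "invertible_on \<Lambda> T \<longleftrightarrow> (\<exists>G. inverse_on \<Lambda> T G)"

definition green :: "('a \<Rightarrow> 'a \<Rightarrow> complex) \<Rightarrow> 'a set \<Rightarrow> 'a \<Rightarrow> 'a \<Rightarrow> complex" where
  "green T \<Lambda> = (THE G. inverse_on \<Lambda> T G)"

definition op_norm_on :: "'a set \<Rightarrow> ('a \<Rightarrow> 'a \<Rightarrow> complex) \<Rightarrow> real" where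
  "op_norm_on \<Lambda> A =
     (SUP v\<in>{v. L2_set (\<lambda>x. cmod (v x)) \<Lambda> \<le> 1}.
        L2_set (\<lambda>x. cmod (\<Sum>y\<in>\<Lambda>. A x y * v y)) \<Lambda>)"

end

theory Submission
  imports Defs
begin

text \<open>
  The solutions of \<open>T\<^sub>\<Omega> u = \<tau> \<delta>\<^sub>y\<close> are bounded by a weighted maximum principle, with the weight
  \<open>exp (h x - \<psi> (x - y))\<close>. Each site \<open>x\<close> has a patch \<open>K \<subseteq> V \<subseteq> \<Omega>\<close>, and applying \<open>G\<^sub>V\<close> to \<open>T (1\<^sub>K u)\<close>
  expresses \<open>u x\<close> through the commutator of \<open>T\<close> with \<open>1\<^sub>K\<close>. A good site takes for \<open>K = V\<close> a window
  inside \<open>\<Omega>\<close>; a site close to a component \<open>A\<close> of \<open>\<Omega>\<^sub>1\<close> takes the neighbourhoods of \<open>A\<close> of radius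
  \<open>M\<^sub>1\<^bsup>\<theta>\<^sub>3\<^esup> / 2\<close> and \<open>M\<^sub>1\<^bsup>\<theta>\<^sub>3\<^esup>\<close>. The weight makes all commutator terms negligible: \<open>h\<close> is a bump on
  \<open>\<Omega>\<^sub>1\<close> whose height beats \<open>exp (M\<^sub>1\<^bsup>\<theta>\<^sub>4\<^esup>)\<close>, and \<open>\<psi> z = L (\<Sum>\<^sub>k (|z\<^sub>k| + a)\<^bsup>c\<^esup> - a\<^bsup>c\<^esup>)\<close> with
  \<open>a = M\<^sub>1\<^bsup>\<theta> - \<delta>\<^esup>\<close>. Since \<open>c < 1\<close>, the shift by \<open>a\<close> costs only a constant in \<open>\<psi>\<close> but makes \<open>\<psi>\<close> smaller
  than \<open>L |z|\<^sub>\<alpha>\<close> by a multiple of \<open>(min |z| a)\<^bsup>c\<^esup>\<close>, which absorbs the loss of every good step, and makes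
  \<open>\<psi>\<close> nearly flat at the scale \<open>M\<^sub>1\<^bsup>\<theta>\<^sub>1\<^esup>\<close> of the components, where \<open>G\<^sub>V\<close> has no decay. The norm bound uses
  \<open>\<psi> = 0\<close>, and \<open>\<tau> = 0\<close> gives invertibility.
\<close>

section \<open>Matrices over finite index sets\<close>

text \<open>Gaussian elimination, one equation per induction step: a nonzero coefficient of the new
  equation is a pivot that removes one unknown from all other equations, so the excess of unknowns
  persists.\<close>

lemma underdetermined_system:
  fixes T :: "'r \<Rightarrow> 'c \<Rightarrow> 'f::field"
  assumes "finite R" "finite C" "card R < card C"
  shows "\<exists>u. (\<exists>y\<in>C. u y \<noteq> 0) \<and> (\<forall>x\<in>R. (\<Sum>y\<in>C. T x y * u y) = 0)"
  using assms
proof (induction R arbitrary: C T rule: finite_induct)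
  case empty
  then have "C \<noteq> {}" by auto
  then show ?case by (intro exI[of _ "\<lambda>_. 1"]) auto
next
  case (insert r R)
  show ?case
  proof (cases "\<forall>y\<in>C. T r y = 0")
    case True
    have "card R < card C" using insert by simp
    from insert.IH[OF insert.prems(1) this, of T] obtain u
      where u: "\<exists>y\<in>C. u y \<noteq> 0" "\<forall>x\<in>R. (\<Sum>y\<in>C. T x y * u y) = 0" by blast
    have "(\<Sum>y\<in>C. T r y * u y) = 0" using True by simp
    with u show ?thesis by auto
  next
    case False
    then obtain c where c: "c \<in> C" "T r c \<noteq> 0" by blast
    \<comment> \<open>Row \<open>x\<close> minus the multiple of row \<open>r\<close> that cancels
      column \<open>c\<close>.\<close>
    define T' where "T' = (\<lambda>x y. T x y - T x c / T r c * T r y)"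
    have "finite (C - {c})" "card R < card (C - {c})"
      using insert c by auto
    from insert.IH[OF this, of T'] obtain u'
      where u': "\<exists>y\<in>C - {c}. u' y \<noteq> 0" "\<forall>x\<in>R. (\<Sum>y\<in>C - {c}. T' x y * u' y) = 0"
      by blast
    define s where "s = (\<Sum>y\<in>C - {c}. T r y * u' y)"
    \<comment> \<open>The value at \<open>c\<close> is the one that makes equation \<open>r\<close>
      hold.\<close>
    define u where "u = u'(c := - s / T r c)"
    have split: "(\<Sum>y\<in>C. T x y * u y) = T x c * (- s / T r c) + (\<Sum>y\<in>C - {c}. T x y * u' y)" for x
    proof -
      have "(\<Sum>y\<in>C. T x y * u y) = T x c * u c + (\<Sum>y\<in>C - {c}. T x y * u y)"
        using insert.prems(1) c(1) by (simp add: sum.remove)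
      also have "(\<Sum>y\<in>C - {c}. T x y * u y) = (\<Sum>y\<in>C - {c}. T x y * u' y)"
        by (rule sum.cong) (auto simp: u_def)
      finally show ?thesis by (simp add: u_def)
    qed
    have "(\<Sum>y\<in>C. T r y * u y) = 0"
      using c(2) by (simp add: split flip: s_def)
    moreover have "(\<Sum>y\<in>C. T x y * u y) = 0" if "x \<in> R" for x
    proof -
      have "0 = (\<Sum>y\<in>C - {c}. T' x y * u' y)" using u'(2) that by simp
      also have "\<dots> = (\<Sum>y\<in>C - {c}. T x y * u' y) - T x c / T r c * s"
        by (simp add: T'_def s_def left_diff_distrib sum_subtractf sum_distrib_left mult.assoc)
      finally show ?thesis by (simp add: split)
    qed
    moreover have "\<exists>y\<in>C. u y \<noteq> 0" using u'(1) by (auto simp: u_def)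
    ultimately show ?thesis by auto
  qed
qed

text \<open>Adding the column \<open>- f\<close> to a square system leaves more unknowns than
  equations. A nonzero solution cannot vanish at the added unknown because the kernel is trivial,
  and dividing by that entry solves \<open>T u = f\<close>. The right inverse obtained in this way
  is a left inverse because \<open>T (G T - 1) = 0\<close>.\<close>

lemma invertible_on_if_trivial_kernel:
  assumes fin: "finite \<Lambda>"
    and ker: "\<And>u. (\<And>x. x \<in> \<Lambda> \<Longrightarrow> (\<Sum>y\<in>\<Lambda>. T x y * u y) = 0) \<Longrightarrow> (\<And>x. x \<in> \<Lambda> \<Longrightarrow> u x = 0)"
  shows "invertible_on \<Lambda> T"
proof -
  have solve: "\<exists>u. \<forall>x\<in>\<Lambda>. (\<Sum>y\<in>\<Lambda>. T x y * u y) = f x" for f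
  proof -
    define C where "C = insert None (Some ` \<Lambda>)"
    define T' where "T' = (\<lambda>x y. case y of None \<Rightarrow> - f x | Some z \<Rightarrow> T x z)"
    have "finite C" "card \<Lambda> < card C"
      using fin by (auto simp: C_def card_image)
    from underdetermined_system[OF fin this, of T'] obtain v
      where v: "\<exists>y\<in>C. v y \<noteq> 0" "\<forall>x\<in>\<Lambda>. (\<Sum>y\<in>C. T' x y * v y) = 0" by blast
    have eq: "(\<Sum>y\<in>\<Lambda>. T x y * v (Some y)) = f x * v None" if "x \<in> \<Lambda>" for x
    proof -
      have "0 = (\<Sum>y\<in>C. T' x y * v y)" using v(2) that by simp
      also have "\<dots> = - f x * v None + (\<Sum>y\<in>\<Lambda>. T x y * v (Some y))"
        using fin by (simp add: C_def T'_def sum.reindex image_iff)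
      finally show ?thesis by simp
    qed
    have "v None \<noteq> 0"
    proof
      assume "v None = 0"
      then have "\<And>x. x \<in> \<Lambda> \<Longrightarrow> v (Some x) = 0"
        using ker[of "\<lambda>y. v (Some y)"] eq by simp
      then show False using v(1) \<open>v None = 0\<close> by (auto simp: C_def)
    qed
    then have "(\<Sum>y\<in>\<Lambda>. T x y * (v (Some y) / v None)) = f x" if "x \<in> \<Lambda>" for x
      using eq[OF that] by (simp flip: sum_divide_distrib)
    then show ?thesis by (intro exI[of _ "\<lambda>y. v (Some y) / v None"]) auto
  qed
  have "\<forall>y. \<exists>u. \<forall>x\<in>\<Lambda>. (\<Sum>z\<in>\<Lambda>. T x z * u z) = (if x = y then 1 else 0)"
    by (rule allI) (rule solve)
  then obtain S where S: "\<And>x y. x \<in> \<Lambda> \<Longrightarrow> (\<Sum>z\<in>\<Lambda>. T x z * S y z) = (if x = y then 1 else 0)"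
    by metis
  define G where "G = (\<lambda>x y. if x \<in> \<Lambda> \<and> y \<in> \<Lambda> then S y x else 0)"
  have right: "(\<Sum>z\<in>\<Lambda>. T x z * G z y) = (if x = y then 1 else 0)" if "x \<in> \<Lambda>" "y \<in> \<Lambda>" for x y
    using S[OF that(1), of y] that by (simp add: G_def cong: sum.cong)
  have left: "(\<Sum>z\<in>\<Lambda>. G x z * T z y) = (if x = y then 1 else 0)" if "x \<in> \<Lambda>" "y \<in> \<Lambda>" for x y
  proof -
    \<comment> \<open>Column \<open>y\<close> of \<open>G T - 1\<close>, which \<open>T\<close>
      annihilates.\<close>
    define u where "u = (\<lambda>x. (\<Sum>z\<in>\<Lambda>. G x z * T z y) - (if x = y then 1 else 0))"
    have "(\<Sum>w\<in>\<Lambda>. T x w * u w) = 0" if "x \<in> \<Lambda>" for x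
    proof -
      have "(\<Sum>w\<in>\<Lambda>. T x w * (\<Sum>z\<in>\<Lambda>. G w z * T z y)) = (\<Sum>z\<in>\<Lambda>. (\<Sum>w\<in>\<Lambda>. T x w * G w z) * T z y)"
        by (simp add: sum_distrib_left sum_distrib_right mult.assoc)
          (rule sum.swap)
      also have "\<dots> = (\<Sum>z\<in>\<Lambda>. if x = z then T z y else 0)"
        by (rule sum.cong) (simp_all add: right that)
      also have "\<dots> = T x y" using fin that by simp
      finally have 1: "(\<Sum>w\<in>\<Lambda>. T x w * (\<Sum>z\<in>\<Lambda>. G w z * T z y)) = T x y" .
      have "(\<Sum>w\<in>\<Lambda>. T x w * (if w = y then 1 else 0)) = (\<Sum>w\<in>\<Lambda>. if w = y then T x w else 0)"
        by (rule sum.cong) auto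
      also have "\<dots> = T x y" using fin \<open>y \<in> \<Lambda>\<close> by simp
      finally show ?thesis using 1 by (simp add: u_def right_diff_distrib sum_subtractf)
    qed
    from ker[OF this that(1)] show ?thesis by (simp add: u_def)
  qed
  have "inverse_on \<Lambda> T G"
    unfolding inverse_on_def using left right by (auto simp: G_def)
  then show ?thesis unfolding invertible_on_def by blast
qed

lemma inverse_on_unique:
  assumes "finite \<Lambda>" "inverse_on \<Lambda> T G" "inverse_on \<Lambda> T G'"
  shows "G = G'"
proof (intro ext)
  fix x y
  show "G x y = G' x y"
  proof (cases "x \<in> \<Lambda> \<and> y \<in> \<Lambda>")
    case True
    have "G x y = (\<Sum>z\<in>\<Lambda>. if z = y then G x z else 0)"
      using True assms(1) by simp
    also have "\<dots> = (\<Sum>z\<in>\<Lambda>. G x z * (\<Sum>w\<in>\<Lambda>. T z w * G' w y))"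
      using assms(3) True by (intro sum.cong) (auto simp: inverse_on_def)
    also have "\<dots> = (\<Sum>w\<in>\<Lambda>. (\<Sum>z\<in>\<Lambda>. G x z * T z w) * G' w y)"
      by (simp add: sum_distrib_left sum_distrib_right mult.assoc) (rule sum.swap)
    also have "\<dots> = (\<Sum>w\<in>\<Lambda>. if x = w then G' w y else 0)"
      using assms(2) True by (intro sum.cong) (auto simp: inverse_on_def)
    also have "\<dots> = G' x y" using True assms(1) by simp
    finally show ?thesis .
  next
    case False
    then show ?thesis using assms(2,3) by (auto simp: inverse_on_def)
  qed
qed

lemma inverse_on_green:
  assumes "finite \<Lambda>" "invertible_on \<Lambda> T"
  shows "inverse_on \<Lambda> T (green T \<Lambda>)"
proof -
  from assms(2) obtain G where "inverse_on \<Lambda> T G" unfolding invertible_on_def by blast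
  moreover have "G' = G" if "inverse_on \<Lambda> T G'" for G'
    by (rule inverse_on_unique[OF assms(1) that \<open>inverse_on \<Lambda> T G\<close>])
  ultimately show ?thesis unfolding green_def by (rule theI)
qed

text \<open>Summing all entries is crude, but the factor \<open>(card \<Lambda>)\<^sup>2\<close> is
  harmless next to exponentials of powers of \<open>M\<^sub>1\<close>.\<close>

lemma L2_apply_le_if_entries_le:
  assumes fin: "finite \<Lambda>" and E: "\<And>x y. x \<in> \<Lambda> \<Longrightarrow> y \<in> \<Lambda> \<Longrightarrow> cmod (A x y) \<le> E"
    and v: "L2_set (\<lambda>x. cmod (v x)) \<Lambda> \<le> 1"
  shows "L2_set (\<lambda>x. cmod (\<Sum>y\<in>\<Lambda>. A x y * v y)) \<Lambda> \<le> (real (card \<Lambda>))\<^sup>2 * E"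
proof -
  have v1: "cmod (v y) \<le> 1" if "y \<in> \<Lambda>" for y
    using member_le_L2_set[OF fin that, of "\<lambda>x. cmod (v x)"] v by linarith
  have "L2_set (\<lambda>x. cmod (\<Sum>y\<in>\<Lambda>. A x y * v y)) \<Lambda> \<le> (\<Sum>x\<in>\<Lambda>. cmod (\<Sum>y\<in>\<Lambda>. A x y * v y))"
    by (rule L2_set_le_sum) simp
  also have "\<dots> \<le> (\<Sum>x\<in>\<Lambda>. \<Sum>y\<in>\<Lambda>. E)"
  proof (intro sum_mono order.trans[OF norm_sum])
    fix x y assume xy: "x \<in> \<Lambda>" "y \<in> \<Lambda>"
    have "cmod (A x y) * cmod (v y) \<le> cmod (A x y) * 1"
      by (intro mult_left_mono v1 xy) simp
    then show "cmod (A x y * v y) \<le> E" using E[OF xy] by (simp add: norm_mult)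
  qed
  also have "\<dots> = (real (card \<Lambda>))\<^sup>2 * E" by (simp add: power2_eq_square)
  finally show ?thesis .
qed

lemma op_norm_on_le_if_entries_le:
  assumes "finite \<Lambda>" "\<And>x y. x \<in> \<Lambda> \<Longrightarrow> y \<in> \<Lambda> \<Longrightarrow> cmod (A x y) \<le> E"
  shows "op_norm_on \<Lambda> A \<le> (real (card \<Lambda>))\<^sup>2 * E"
  unfolding op_norm_on_def
proof (rule cSUP_least)
  show "{v. L2_set (\<lambda>x. cmod (v x)) \<Lambda> \<le> 1} \<noteq> {}"
    unfolding ex_in_conv[symmetric] mem_Collect_eq
    by (rule exI[of _ "\<lambda>_. 0"]) (simp add: L2_set_def)
qed (use L2_apply_le_if_entries_le[OF assms] in auto)

text \<open>The operator is tested on the unit vector at \<open>y\<close>. The crude bound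
  \<open>E\<close> shows that the supremum in \<open>op_norm_on\<close> is taken over a bounded set,
  so that it dominates its members.\<close>

lemma entry_le_op_norm_on:
  assumes fin: "finite \<Lambda>" and xy: "x \<in> \<Lambda>" "y \<in> \<Lambda>"
  shows "cmod (A x y) \<le> op_norm_on \<Lambda> A"
proof -
  define E where "E = (\<Sum>x\<in>\<Lambda>. \<Sum>y\<in>\<Lambda>. cmod (A x y))"
  have E: "cmod (A x y) \<le> E" if "x \<in> \<Lambda>" "y \<in> \<Lambda>" for x y
  proof -
    have "cmod (A x y) \<le> (\<Sum>y\<in>\<Lambda>. cmod (A x y))"
      using fin that by (intro member_le_sum) auto
    also have "\<dots> \<le> E" unfolding E_def
      using fin that by (intro member_le_sum[of x \<Lambda> "\<lambda>x. \<Sum>y\<in>\<Lambda>. cmod (A x y)"])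
        (auto intro: sum_nonneg)
    finally show ?thesis .
  qed
  define v :: "'a \<Rightarrow> complex" where "v = (\<lambda>z. if z = y then 1 else 0)"
  have "(\<Sum>x\<in>\<Lambda>. (cmod (v x))\<^sup>2) = (\<Sum>x\<in>\<Lambda>. if x = y then 1 else 0)"
    by (rule sum.cong) (auto simp: v_def)
  then have "L2_set (\<lambda>x. cmod (v x)) \<Lambda> \<le> 1"
    using fin xy by (simp add: L2_set_def)
  have "(\<Sum>z\<in>\<Lambda>. A x z * v z) = (\<Sum>z\<in>\<Lambda>. if z = y then A x z else 0)"
    by (rule sum.cong) (auto simp: v_def)
  then have "cmod (A x y) = cmod (\<Sum>z\<in>\<Lambda>. A x z * v z)"
    using fin xy by simp
  also have "\<dots> \<le> L2_set (\<lambda>x. cmod (\<Sum>z\<in>\<Lambda>. A x z * v z)) \<Lambda>"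
    using member_le_L2_set[OF fin xy(1), of "\<lambda>x. cmod (\<Sum>z\<in>\<Lambda>. A x z * v z)"] .
  also have "\<dots> \<le> op_norm_on \<Lambda> A" unfolding op_norm_on_def
  proof (rule cSUP_upper)
    show "bdd_above ((\<lambda>v. L2_set (\<lambda>x. cmod (\<Sum>y\<in>\<Lambda>. A x y * v y)) \<Lambda>) `
        {v. L2_set (\<lambda>x. cmod (v x)) \<Lambda> \<le> 1})"
      using L2_apply_le_if_entries_le[OF fin E] by (intro bdd_aboveI2) auto
  qed (use \<open>L2_set (\<lambda>x. cmod (v x)) \<Lambda> \<le> 1\<close> in simp)
  finally show ?thesis .
qed

text \<open>\<open>G\<close> inverts \<open>T\<close> on \<open>V\<close>, which contains
  \<open>K\<close>, hence \<open>1\<^sub>K u = G T (1\<^sub>K u)\<close> on \<open>V\<close>;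
  moreover \<open>T (1\<^sub>K u) = 1\<^sub>K T u + [T, 1\<^sub>K] u\<close>.\<close>

lemma cutoff_identity:
  assumes fin: "finite \<Omega>" and sub: "x \<in> K" "K \<subseteq> V" "V \<subseteq> \<Omega>" and G: "inverse_on V T G"
    and eq: "\<And>p. p \<in> \<Omega> \<Longrightarrow> (\<Sum>q\<in>\<Omega>. T p q * u q) = f p"
  shows "u x = (\<Sum>p\<in>V. G x p * (indicator K p * f p +
           (\<Sum>q\<in>\<Omega>. T p q * (indicator K q - indicator K p) * u q)))"
proof -
  have "finite V" using fin sub by (auto intro: finite_subset)
  have "(\<Sum>p\<in>V. G x p * (indicator K p * f p +
           (\<Sum>q\<in>\<Omega>. T p q * (indicator K q - indicator K p) * u q)))
      = (\<Sum>p\<in>V. G x p * (\<Sum>q\<in>V. T p q * (indicator K q * u q)))"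
  proof (intro sum.cong refl arg_cong2[where f = "(*)"])
    fix p assume "p \<in> V"
    then have "p \<in> \<Omega>" using sub by auto
    have "indicator K p * f p + (\<Sum>q\<in>\<Omega>. T p q * (indicator K q - indicator K p) * u q)
        = (\<Sum>q\<in>\<Omega>. T p q * (indicator K q * u q))"
      unfolding eq[OF \<open>p \<in> \<Omega>\<close>, symmetric] sum_distrib_left sum.distrib[symmetric]
      by (rule sum.cong) (auto simp: algebra_simps)
    also have "\<dots> = (\<Sum>q\<in>V. T p q * (indicator K q * u q))"
      using fin sub by (intro sum.mono_neutral_right) (auto simp: indicator_def)
    finally show "indicator K p * f p + (\<Sum>q\<in>\<Omega>. T p q * (indicator K q - indicator K p) * u q)
        = (\<Sum>q\<in>V. T p q * (indicator K q * u q))" .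
  qed
  also have "\<dots> = (\<Sum>q\<in>V. (\<Sum>p\<in>V. G x p * T p q) * (indicator K q * u q))"
    by (simp add: sum_distrib_left sum_distrib_right mult.assoc) (rule sum.swap)
  also have "\<dots> = (\<Sum>q\<in>V. if x = q then u q else 0)"
    using G sub by (intro sum.cong) (auto simp: inverse_on_def)
  also have "\<dots> = u x" using \<open>finite V\<close> sub by auto
  finally show ?thesis by simp
qed

text \<open>The weighted supremum \<open>X\<close> of \<open>u\<close> is attained, and
  \<open>cutoff_identity\<close> at that site bounds it by the source term plus
  \<open>X / 2\<close>: there are at most \<open>(card \<Omega>)\<^sup>2\<close> commutator terms,
  and relative to the weight each is at most \<open>X * exp (- \<Lambda>)\<close>. As
  \<open>X\<close> is finite, the half can be absorbed, so no resolvent expansion has to be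
  iterated.\<close>

lemma weighted_maximum_principle:
  fixes H :: "'a \<Rightarrow> real"
  assumes fin: "finite \<Omega>" and F: "F \<ge> 0"
    and eq: "\<And>p. p \<in> \<Omega> \<Longrightarrow> (\<Sum>q\<in>\<Omega>. T p q * u q) = (if p = y then \<tau> else 0)"
    and \<Lambda>: "2 * (real (card \<Omega>))\<^sup>2 \<le> exp \<Lambda>"
    and patch: "\<And>x. x \<in> \<Omega> \<Longrightarrow> \<exists>K V G. x \<in> K \<and> K \<subseteq> V \<and> V \<subseteq> \<Omega> \<and> inverse_on V T G \<and>
       (y \<in> K \<longrightarrow> cmod (G x y) \<le> F * exp (H x)) \<and>
       (\<forall>p\<in>V. \<forall>q\<in>\<Omega>. (p \<in> K) \<noteq> (q \<in> K) \<longrightarrow>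
          cmod (G x p) * cmod (T p q) \<le> exp (H x - H q - \<Lambda>))"
    and x: "x \<in> \<Omega>"
  shows "cmod (u x) \<le> 2 * F * cmod \<tau> * exp (H x)"
proof -
  define X where "X = Max ((\<lambda>x. cmod (u x) * exp (- H x)) ` \<Omega>)"
  have ne: "\<Omega> \<noteq> {}" using x by auto
  have X: "cmod (u z) * exp (- H z) \<le> X" if "z \<in> \<Omega>" for z
    unfolding X_def using fin that by simp
  have Xu: "cmod (u z) \<le> X * exp (H z)" if "z \<in> \<Omega>" for z
    using X[OF that] by (simp add: exp_minus field_simps)
  have X0: "X \<ge> 0"
    using order.trans[OF mult_nonneg_nonneg X[OF x]] by simp
  have step: "cmod (u x) * exp (- H x) \<le> F * cmod \<tau> + X / 2" if x: "x \<in> \<Omega>" for x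
  proof -
    from patch[OF x] obtain K V G where sub: "x \<in> K" "K \<subseteq> V" "V \<subseteq> \<Omega>"
      and G: "inverse_on V T G"
      and Gy: "y \<in> K \<longrightarrow> cmod (G x y) \<le> F * exp (H x)"
      and GT: "\<And>p q. p \<in> V \<Longrightarrow> q \<in> \<Omega> \<Longrightarrow> (p \<in> K) \<noteq> (q \<in> K) \<Longrightarrow>
          cmod (G x p) * cmod (T p q) \<le> exp (H x - H q - \<Lambda>)"
      by blast
    have finV: "finite V" using fin sub by (auto intro: finite_subset)
    have "u x = (\<Sum>p\<in>V. G x p * (indicator K p * (if p = y then \<tau> else 0) +
           (\<Sum>q\<in>\<Omega>. T p q * (indicator K q - indicator K p) * u q)))"
      by (rule cutoff_identity[OF fin sub G eq])
    also have "\<dots> = (\<Sum>p\<in>V. if p = y then G x p * (indicator K p * \<tau>) else 0) +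
          (\<Sum>p\<in>V. \<Sum>q\<in>\<Omega>. G x p * (T p q * (indicator K q - indicator K p) * u q))"
      unfolding sum.distrib[symmetric]
      by (intro sum.cong refl) (simp add: distrib_left sum_distrib_left)
    finally have ux: "u x = \<dots>" .
    have "cmod (u x) \<le> cmod (\<Sum>p\<in>V. if p = y then G x p * (indicator K p * \<tau>) else 0) +
          cmod (\<Sum>p\<in>V. \<Sum>q\<in>\<Omega>. G x p * (T p q * (indicator K q - indicator K p) * u q))"
      unfolding ux by (rule norm_triangle_ineq)
    also have "cmod (\<Sum>p\<in>V. if p = y then G x p * (indicator K p * \<tau>) else 0)
        \<le> F * exp (H x) * cmod \<tau>"
    proof (cases "y \<in> K")
      case True
      then have "(\<Sum>p\<in>V. if p = y then G x p * (indicator K p * \<tau>) else 0) = G x y * \<tau>"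
        using finV sub by auto
      then show ?thesis using Gy True by (simp add: norm_mult mult_right_mono)
    next
      case False
      then have "(\<Sum>p\<in>V. if p = y then G x p * (indicator K p * \<tau>) else 0) = 0"
        using finV by simp
      then show ?thesis using F by simp
    qed
    also have "cmod (\<Sum>p\<in>V. \<Sum>q\<in>\<Omega>. G x p * (T p q * (indicator K q - indicator K p) * u q))
        \<le> (\<Sum>p\<in>\<Omega>. \<Sum>q\<in>\<Omega>. X * exp (H x - \<Lambda>))"
    proof -
      have "cmod (\<Sum>p\<in>V. \<Sum>q\<in>\<Omega>. G x p * (T p q * (indicator K q - indicator K p) * u q))
        \<le> (\<Sum>p\<in>V. \<Sum>q\<in>\<Omega>. X * exp (H x - \<Lambda>))"
      proof (intro order.trans[OF norm_sum] sum_mono)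
        fix p q assume p: "p \<in> V" and q: "q \<in> \<Omega>"
        show "cmod (G x p * (T p q * (indicator K q - indicator K p) * u q)) \<le> X * exp (H x - \<Lambda>)"
        proof (cases "(p \<in> K) = (q \<in> K)")
          case True
          then have "indicator K q - indicator K p = (0::complex)" by (auto simp: indicator_def)
          then show ?thesis using X0 by simp
        next
          case False
          then have "cmod (indicator K q - indicator K p) = 1" by (auto simp: indicator_def)
          then have "cmod (G x p * (T p q * (indicator K q - indicator K p) * u q))
              = (cmod (G x p) * cmod (T p q)) * cmod (u q)" by (simp add: norm_mult)
          also have "\<dots> \<le> exp (H x - H q - \<Lambda>) * (X * exp (H q))"
            by (intro mult_mono GT p q False Xu) auto
          also have "\<dots> = X * exp (H x - \<Lambda>)" by (simp add: mult_ac flip: exp_add)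
          finally show ?thesis .
        qed
      qed
      also have "\<dots> \<le> (\<Sum>p\<in>\<Omega>. \<Sum>q\<in>\<Omega>. X * exp (H x - \<Lambda>))"
        using fin sub X0 by (intro sum_mono2) (auto intro: sum_nonneg)
      finally show ?thesis .
    qed
    also have "(\<Sum>p\<in>\<Omega>. \<Sum>q\<in>\<Omega>. X * exp (H x - \<Lambda>)) = (real (card \<Omega>))\<^sup>2 * (X * exp (H x - \<Lambda>))"
      by (simp add: power2_eq_square)
    also have "\<dots> \<le> exp \<Lambda> / 2 * (X * exp (H x - \<Lambda>))"
      using \<Lambda> X0 by (intro mult_right_mono) auto
    also have "\<dots> = X / 2 * exp (H x)" by (simp add: mult_ac flip: exp_add)
    finally have "cmod (u x) \<le> (F * cmod \<tau> + X / 2) * exp (H x)"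
      by (simp add: algebra_simps)
    then show ?thesis by (simp add: exp_minus field_simps)
  qed
  have "X \<in> (\<lambda>x. cmod (u x) * exp (- H x)) ` \<Omega>"
    unfolding X_def using fin ne by (intro Max_in) auto
  then obtain z where "z \<in> \<Omega>" "X = cmod (u z) * exp (- H z)" by auto
  with step[of z] have "X \<le> F * cmod \<tau> + X / 2" by simp
  then have "X \<le> 2 * F * cmod \<tau>" by simp
  then have "X * exp (H x) \<le> 2 * F * cmod \<tau> * exp (H x)" by (rule mult_right_mono) simp
  then show ?thesis using Xu[OF x] by linarith
qed

section \<open>Norms on the lattice\<close>

text \<open>Concavity of the power: its increments over a fixed length \<open>s\<close> decrease.
  Starting at \<open>A > 0\<close> keeps the derivative away from the origin.\<close>

lemma powr_increment_antimono:
  fixes s t A c :: real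
  assumes "s \<ge> 0" "t \<ge> 0" "A > 0" "0 < c" "c < 1"
  shows "(s + t + A) powr c - (t + A) powr c \<le> (s + A) powr c - A powr c"
proof -
  have "(s + (t + A)) powr c - (t + A) powr c \<le> (s + A) powr c - A powr c"
  proof (rule DERIV_nonpos_imp_nonincreasing[of A "t + A" "\<lambda>t. (s + t) powr c - t powr c"])
    fix x assume x: "A \<le> x" "x \<le> t + A"
    have "((\<lambda>t. (s + t) powr c - t powr c) has_real_derivative
        c * (s + x) powr (c - 1) - c * x powr (c - 1)) (at x)"
      using x assms by (auto intro!: derivative_eq_intros)
    moreover have "(s + x) powr (c - 1) \<le> x powr (c - 1)"
      using assms x by (intro powr_mono2') auto
    ultimately show "\<exists>y. ((\<lambda>t. (s + t) powr c - t powr c) has_real_derivative y) (at x) \<and> y \<le> 0"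
      using assms by (intro exI conjI) auto
  qed (use assms in auto)
  then show ?thesis by (simp add: add.assoc)
qed

text \<open>Quantitative strict subadditivity, the source of the gain in the weight. For
  \<open>s \<le> t\<close> the increment of length \<open>s\<close> at \<open>t\<close> is at most
  the one at \<open>s\<close>, which is \<open>(2 powr c - 1) * s powr c\<close>.\<close>

lemma powr_add_gain:
  fixes s t c :: real
  assumes "s \<ge> 0" "t \<ge> 0" "0 < c" "c < 1"
  shows "(s + t) powr c \<le> s powr c + t powr c - (2 - 2 powr c) * min s t powr c"
  using assms(1,2)
proof (induction s t rule: linorder_wlog)
  case (le s t)
  show ?case
  proof (cases "s = 0")
    case False
    then have s: "s > 0" using le by simp
    have "(s + t) powr c - t powr c \<le> (s + s) powr c - s powr c"
      using powr_increment_antimono[of s "t - s" s c] assms(3,4) le s by (simp add: add.commute)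
    moreover have "(s + s) powr c = 2 powr c * s powr c"
      using s by (simp flip: powr_mult)
    ultimately show ?thesis using le by (simp add: algebra_simps)
  qed (use le in simp)
next
  case (sym s t)
  then show ?case by (simp add: add.commute min.commute)
qed

lemma two_powr_bounds:
  fixes c :: real
  assumes "0 < c" "c < 1"
  shows "1 < (2::real) powr c" "(2::real) powr c < 2"
  using powr_less_mono[of 0 c 2] powr_less_mono[of c 1 2] assms by auto

lemma powr_subadditive:
  fixes s t c :: real
  assumes "s \<ge> 0" "t \<ge> 0" "0 < c" "c < 1"
  shows "(s + t) powr c \<le> s powr c + t powr c"
proof -
  have "(2 - 2 powr c) * min s t powr c \<ge> 0"
    using two_powr_bounds[OF assms(3,4)] by simp
  then show ?thesis using powr_add_gain[OF assms] by linarith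
qed

text \<open>Both factors of a site are merged into one index type, so that norms and boxes need a
  single coordinatewise argument.\<close>

fun coordinate :: "('b::finite, 'd::finite) site \<Rightarrow> 'b + 'd \<Rightarrow> int" where
  "coordinate x (Inl i) = fst x $ i"
| "coordinate x (Inr j) = snd x $ j"

lemma coordinate_add [simp]: "coordinate (x + y) k = coordinate x k + coordinate y k"
  and coordinate_diff [simp]: "coordinate (x - y) k = coordinate x k - coordinate y k"
  by (cases k; simp)+

lemma sum_coordinates:
  fixes x :: "('b::finite, 'd::finite) site" and f :: "int \<Rightarrow> 'x::comm_monoid_add"
  shows "(\<Sum>k\<in>UNIV. f (coordinate x k)) = (\<Sum>i\<in>UNIV. f (fst x $ i)) + (\<Sum>j\<in>UNIV. f (snd x $ j))"
  by (subst UNIV_Plus_UNIV[symmetric], subst sum.Plus) simp_all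

lemma alpha_norm_coordinates:
  "alpha_norm \<alpha> x = (\<Sum>k\<in>UNIV. \<bar>real_of_int (coordinate x k)\<bar> powr (1 / \<alpha>))"
  unfolding alpha_norm_def by (rule sum_coordinates[symmetric])

lemma max_norm_coordinates: "max_norm x = real_of_int (Max (range (\<lambda>k. \<bar>coordinate x k\<bar>)))"
proof -
  have "range (\<lambda>k. \<bar>coordinate x k\<bar>) = range (\<lambda>i. \<bar>fst x $ i\<bar>) \<union> range (\<lambda>j. \<bar>snd x $ j\<bar>)"
    by (subst UNIV_Plus_UNIV[symmetric]) (simp only: Plus_def image_Un image_image coordinate.simps)
  then show ?thesis by (simp add: max_norm_def)
qed

lemma coordinate_le_max_norm: "\<bar>real_of_int (coordinate x k)\<bar> \<le> max_norm x"
proof -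
  have "\<bar>coordinate x k\<bar> \<le> Max (range (\<lambda>k. \<bar>coordinate x k\<bar>))" by (rule Max_ge) auto
  then show ?thesis unfolding max_norm_coordinates by linarith
qed

lemma max_norm_attained: "\<exists>k. max_norm x = \<bar>real_of_int (coordinate x k)\<bar>"
proof -
  have "Max (range (\<lambda>k. \<bar>coordinate x k\<bar>)) \<in> range (\<lambda>k. \<bar>coordinate x k\<bar>)"
    by (rule Max_in) auto
  then show ?thesis unfolding max_norm_coordinates by force
qed

lemma max_norm_le_iff: "max_norm x \<le> r \<longleftrightarrow> (\<forall>k. \<bar>real_of_int (coordinate x k)\<bar> \<le> r)"
  by (metis coordinate_le_max_norm max_norm_attained order.trans)

lemma max_norm_nonneg [simp]: "max_norm x \<ge> 0"
  using max_norm_attained[of x] by auto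

lemma max_norm_triangle: "max_norm (x + y) \<le> max_norm x + max_norm y"
  unfolding max_norm_le_iff[of "x + y"]
proof
  fix k
  show "\<bar>real_of_int (coordinate (x + y) k)\<bar> \<le> max_norm x + max_norm y"
    using coordinate_le_max_norm[of x k] coordinate_le_max_norm[of y k] by simp
qed

lemma max_norm_dist_triangle: "max_norm (x - z) \<le> max_norm (x - y) + max_norm (y - z)"
  using max_norm_triangle[of "x - y" "y - z"] by simp

lemma max_norm_minus_commute: "max_norm (x - y) = max_norm (y - x)"
  by (simp add: max_norm_coordinates abs_minus_commute)

lemma alpha_norm_nonneg [simp]: "alpha_norm \<alpha> x \<ge> 0"
  unfolding alpha_norm_coordinates by (intro sum_nonneg) simp

lemma alpha_norm_triangle:
  assumes "\<alpha> > 1"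
  shows "alpha_norm \<alpha> (x + y) \<le> alpha_norm \<alpha> x + alpha_norm \<alpha> y"
  unfolding alpha_norm_coordinates sum.distrib[symmetric]
proof (rule sum_mono)
  fix k
  have "\<bar>real_of_int (coordinate (x + y) k)\<bar> powr (1 / \<alpha>)
      \<le> (\<bar>real_of_int (coordinate x k)\<bar> + \<bar>real_of_int (coordinate y k)\<bar>) powr (1 / \<alpha>)"
    using assms by (intro powr_mono2) auto
  also have "\<dots> \<le> \<bar>real_of_int (coordinate x k)\<bar> powr (1 / \<alpha>) + \<bar>real_of_int (coordinate y k)\<bar> powr (1 / \<alpha>)"
    using assms by (intro powr_subadditive) auto
  finally show "\<bar>real_of_int (coordinate (x + y) k)\<bar> powr (1 / \<alpha>) \<le> \<dots>" .
qed

lemma alpha_norm_ge: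
  assumes "\<alpha> > 0"
  shows "max_norm x powr (1 / \<alpha>) \<le> alpha_norm \<alpha> x"
proof -
  from max_norm_attained[of x] obtain k where k: "max_norm x = \<bar>real_of_int (coordinate x k)\<bar>" by blast
  show ?thesis unfolding k alpha_norm_coordinates
    by (intro member_le_sum[of k UNIV "\<lambda>k. \<bar>real_of_int (coordinate x k)\<bar> powr (1 / \<alpha>)"]) auto
qed

lemma alpha_norm_le:
  fixes x :: "('b::finite, 'd::finite) site"
  assumes "\<alpha> > 0" "max_norm x \<le> r"
  shows "alpha_norm \<alpha> x \<le> real (CARD('b) + CARD('d)) * r powr (1 / \<alpha>)"
proof -
  have "alpha_norm \<alpha> x \<le> (\<Sum>k\<in>(UNIV :: ('b + 'd) set). r powr (1 / \<alpha>))"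
    unfolding alpha_norm_coordinates using assms
    by (intro sum_mono powr_mono2) (auto simp: max_norm_le_iff)
  then show ?thesis by simp
qed

text \<open>Up to the factor \<open>L\<close> this is the weight \<open>\<psi>\<close> with shift
  \<open>A\<close>; the subtracted constant makes it vanish at the origin.\<close>

definition shifted_norm :: "real \<Rightarrow> real \<Rightarrow> ('b::finite, 'd::finite) site \<Rightarrow> real" where
  "shifted_norm c A x = (\<Sum>k\<in>UNIV. (\<bar>real_of_int (coordinate x k)\<bar> + A) powr c - A powr c)"

text \<open>Each summand is increasing and concave in the absolute value of its coordinate and
  vanishes at 0, hence is subadditive.\<close>

lemma shifted_norm_triangle:
  assumes "0 < c" "c < 1" "A > 0"
  shows "shifted_norm c A (x + y) \<le> shifted_norm c A x + shifted_norm c A y"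
  unfolding shifted_norm_def sum.distrib[symmetric]
proof (rule sum_mono)
  fix k
  define s t where "s = \<bar>real_of_int (coordinate x k)\<bar>" and "t = \<bar>real_of_int (coordinate y k)\<bar>"
  have "(\<bar>real_of_int (coordinate (x + y) k)\<bar> + A) powr c \<le> (s + t + A) powr c"
    using assms by (intro powr_mono2) (auto simp: s_def t_def)
  also have "\<dots> \<le> (t + A) powr c + (s + A) powr c - A powr c"
    using powr_increment_antimono[of s t A c] assms by (simp add: s_def t_def)
  finally show "(\<bar>real_of_int (coordinate (x + y) k)\<bar> + A) powr c - A powr c
      \<le> (\<bar>real_of_int (coordinate x k)\<bar> + A) powr c - A powr c
        + ((\<bar>real_of_int (coordinate y k)\<bar> + A) powr c - A powr c)"
    by (simp add: s_def t_def)
qed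

text \<open>\<open>powr_add_gain\<close> is applied to each coordinate and the shift. Every
  coordinate yields a nonnegative gain, and that of a largest coordinate is kept.\<close>

lemma shifted_norm_le_alpha_norm:
  assumes "\<alpha> > 1" "A > 0"
  shows "shifted_norm (1 / \<alpha>) A x
    \<le> alpha_norm \<alpha> x - (2 - 2 powr (1 / \<alpha>)) * min (max_norm x) A powr (1 / \<alpha>)"
proof -
  define c where "c = 1 / \<alpha>"
  have c: "0 < c" "c < 1" using assms by (auto simp: c_def)
  note \<gamma> = two_powr_bounds[OF c]
  from max_norm_attained[of x] obtain k0 where k0: "max_norm x = \<bar>real_of_int (coordinate x k0)\<bar>" by blast
  let ?m = "\<lambda>k. (2 - 2 powr c) * min \<bar>real_of_int (coordinate x k)\<bar> A powr c"
  have "shifted_norm c A x \<le> (\<Sum>k\<in>UNIV. \<bar>real_of_int (coordinate x k)\<bar> powr c - ?m k)"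
    unfolding shifted_norm_def
  proof (rule sum_mono)
    fix k
    show "(\<bar>real_of_int (coordinate x k)\<bar> + A) powr c - A powr c
      \<le> \<bar>real_of_int (coordinate x k)\<bar> powr c - ?m k"
      using powr_add_gain[of "\<bar>real_of_int (coordinate x k)\<bar>" A c] assms c by simp
  qed
  also have "\<dots> = alpha_norm \<alpha> x - (\<Sum>k\<in>UNIV. ?m k)"
    by (simp add: alpha_norm_coordinates sum_subtractf c_def)
  finally have "shifted_norm c A x \<le> alpha_norm \<alpha> x - (\<Sum>k\<in>UNIV. ?m k)" .
  moreover have "?m k0 \<le> (\<Sum>k\<in>UNIV. ?m k)"
    using \<gamma> by (intro member_le_sum) auto
  ultimately show ?thesis by (simp add: c_def k0)
qed

text \<open>The shift loses at most \<open>A powr (1 / \<alpha>)\<close> per coordinate, however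
  large \<open>x\<close> is; this preserves the decay rate at long distances.\<close>

lemma shifted_norm_ge:
  fixes x :: "('b::finite, 'd::finite) site"
  assumes "\<alpha> > 0" "A \<ge> 0"
  shows "alpha_norm \<alpha> x - real (CARD('b) + CARD('d)) * A powr (1 / \<alpha>) \<le> shifted_norm (1 / \<alpha>) A x"
proof -
  have "(\<Sum>k\<in>(UNIV :: ('b + 'd) set). \<bar>real_of_int (coordinate x k)\<bar> powr (1 / \<alpha>) - A powr (1 / \<alpha>))
      \<le> shifted_norm (1 / \<alpha>) A x"
    unfolding shifted_norm_def using assms by (intro sum_mono diff_right_mono powr_mono2) auto
  then show ?thesis
    by (simp add: sum_subtractf alpha_norm_coordinates)
qed

text \<open>Bernoulli's inequality \<open>(1 + t / A) powr c \<le> 1 + t / A\<close> bounds the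
  slope by \<open>A powr (c - 1)\<close>, so the weight is nearly flat at scales far below
  \<open>A\<close>.\<close>

lemma shifted_norm_le:
  fixes x :: "('b::finite, 'd::finite) site"
  assumes "0 < c" "c < 1" "A > 0" "max_norm x \<le> r"
  shows "shifted_norm c A x \<le> real (CARD('b) + CARD('d)) * (A powr (c - 1) * r)"
proof -
  have "shifted_norm c A x \<le> (\<Sum>k\<in>(UNIV :: ('b + 'd) set). A powr (c - 1) * r)"
    unfolding shifted_norm_def
  proof (rule sum_mono)
    fix k
    define t where "t = \<bar>real_of_int (coordinate x k)\<bar>"
    have t: "0 \<le> t" "t \<le> r" using assms by (auto simp: t_def max_norm_le_iff)
    have "t + A = A * (1 + t / A)" using assms by (simp add: field_simps)
    then have "(t + A) powr c = A powr c * (1 + t / A) powr c"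
      using assms t by (simp add: powr_mult)
    also have "\<dots> \<le> A powr c * (1 + t / A) powr 1"
      using assms t by (intro mult_left_mono powr_mono) auto
    also have "\<dots> = A powr c + A powr (c - 1) * t"
      using assms t by (simp add: field_simps powr_diff)
    also have "\<dots> \<le> A powr c + A powr (c - 1) * r"
      using t by (intro add_left_mono mult_left_mono) auto
    finally show "(\<bar>real_of_int (coordinate x k)\<bar> + A) powr c - A powr c \<le> A powr (c - 1) * r"
      by (simp add: t_def)
  qed
  then show ?thesis by simp
qed

section \<open>Boxes, windows and bumps\<close>

lemma obtain_site: obtains x :: "('b::finite, 'd::finite) site" where "\<And>k. coordinate x k = f k"
proof (rule that)
  show "coordinate (\<chi> i. f (Inl i), \<chi> j. f (Inr j)) k = f k" for k
    by (cases k) simp_all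
qed

lemma inj_coordinate: "inj (coordinate :: ('b::finite, 'd::finite) site \<Rightarrow> _)"
proof (rule injI)
  fix x y :: "('b, 'd) site"
  assume "coordinate x = coordinate y"
  then have "coordinate x (Inl i) = coordinate y (Inl i)" "coordinate x (Inr j) = coordinate y (Inr j)" for i j
    by simp_all
  then show "x = y" by (simp add: prod_eq_iff vec_eq_iff)
qed

definition site_box :: "('b + 'd \<Rightarrow> int) \<Rightarrow> ('b + 'd \<Rightarrow> int) \<Rightarrow> ('b::finite, 'd::finite) site set" where
  "site_box lo hi = {x. \<forall>k. lo k \<le> coordinate x k \<and> coordinate x k \<le> hi k}"

lemma site_box_finite_card:
  fixes lo hi :: "'b::finite + 'd::finite \<Rightarrow> int"
  assumes "\<And>k. hi k - lo k \<le> 2 * int M"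
  shows "finite (site_box lo hi)" "card (site_box lo hi) \<le> (2 * M + 1) ^ (CARD('b) + CARD('d))"
proof -
  have sub: "coordinate ` site_box lo hi \<subseteq> PiE UNIV (\<lambda>k. {lo k..hi k})"
    by (auto simp: site_box_def)
  have fin: "finite (PiE UNIV (\<lambda>k. {lo k..hi k}))" by (intro finite_PiE) auto
  have inj: "inj_on coordinate (site_box lo hi)" using inj_coordinate by (rule inj_on_subset) simp
  show "finite (site_box lo hi)"
    using finite_subset[OF sub fin] inj by (rule finite_imageD)
  have "card (site_box lo hi) = card (coordinate ` site_box lo hi)"
    using inj by (simp add: card_image)
  also have "\<dots> \<le> card (PiE UNIV (\<lambda>k. {lo k..hi k}))"
    by (rule card_mono[OF fin sub])
  also have "\<dots> = (\<Prod>k\<in>UNIV. card {lo k..hi k})" by (rule card_PiE) simp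
  also have "\<dots> \<le> (\<Prod>k\<in>(UNIV :: ('b + 'd) set). 2 * M + 1)"
  proof (intro prod_mono conjI)
    fix k show "card {lo k..hi k} \<le> 2 * M + 1" using assms[of k] by simp
  qed simp
  also have "\<dots> = (2 * M + 1) ^ (CARD('b) + CARD('d))" by simp
  finally show "card (site_box lo hi) \<le> (2 * M + 1) ^ (CARD('b) + CARD('d))" .
qed

text \<open>Rounding a real corner inward may leave only \<open>M\<close> integers in a direction of
  \<open>Q\<close>, whence the lower bound \<open>M - 1\<close> on the side; the upper bound
  \<open>2 * M\<close> is attained in the directions of \<open>int_box\<close>.\<close>

lemma region_is_site_box:
  assumes "cube_interval M Q"
  obtains lo hi :: "'b::finite + 'd::finite \<Rightarrow> int"
  where "int_box M \<times> Q = site_box lo hi"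
    "\<And>k. hi k - lo k \<le> 2 * int M" "\<And>k. int M - 1 \<le> hi k - lo k"
proof -
  from assms obtain a :: "real ^ 'd" where
    Q: "Q = {n. \<forall>i. a $ i \<le> real_of_int (n $ i) \<and> real_of_int (n $ i) \<le> a $ i + real M}"
    unfolding cube_interval_def by blast
  define lo where "lo = case_sum (\<lambda>i::'b. - int M) (\<lambda>j. \<lceil>a $ j\<rceil>)"
  define hi where "hi = case_sum (\<lambda>i::'b. int M) (\<lambda>j. \<lfloor>a $ j + real M\<rfloor>)"
  have "int_box M \<times> Q = site_box lo hi"
  proof (intro set_eqI)
    fix x :: "('b, 'd) site"
    have "x \<in> site_box lo hi \<longleftrightarrow> (\<forall>i. lo (Inl i) \<le> coordinate x (Inl i) \<and> coordinate x (Inl i) \<le> hi (Inl i))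
      \<and> (\<forall>j. lo (Inr j) \<le> coordinate x (Inr j) \<and> coordinate x (Inr j) \<le> hi (Inr j))"
      unfolding site_box_def mem_Collect_eq by (metis sum.exhaust)
    also have "\<dots> \<longleftrightarrow> x \<in> int_box M \<times> Q"
      unfolding lo_def hi_def sum.case ceiling_le_iff le_floor_iff
      by (cases x) (simp add: Q int_box_def)
    finally show "x \<in> int_box M \<times> Q \<longleftrightarrow> x \<in> site_box lo hi" by simp
  qed
  moreover have "hi k - lo k \<le> 2 * int M" "int M - 1 \<le> hi k - lo k" for k
    by (cases k; simp add: lo_def hi_def; linarith)+
  ultimately show ?thesis using that by blast
qed

lemma window_iff: "z \<in> window M x \<longleftrightarrow> max_norm (z - x) \<le> real M"
proof -
  have shift: "v \<in> (+) a ` S \<longleftrightarrow> v - a \<in> S" for v a :: "'x::ab_group_add" and S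
    by (metis (no_types, lifting) add.commute diff_add_cancel image_iff add_diff_cancel_left')
  have "z \<in> window M x \<longleftrightarrow> (\<forall>i. \<bar>coordinate (z - x) (Inl i)\<bar> \<le> int M) \<and> (\<forall>j. \<bar>coordinate (z - x) (Inr j)\<bar> \<le> int M)"
    by (simp add: window_def mem_Times_iff shift int_box_def abs_le_iff) (smt (verit))
  also have "\<dots> \<longleftrightarrow> (\<forall>k. \<bar>coordinate (z - x) k\<bar> \<le> int M)"
    by (metis sum.exhaust)
  also have "\<dots> \<longleftrightarrow> max_norm (z - x) \<le> real M"
    unfolding max_norm_le_iff by (metis of_int_abs of_int_le_iff of_int_of_nat_eq)
  finally show ?thesis .
qed

text \<open>A window centred near the boundary sticks out of the box, so every site is covered by
  the window around its projection onto the sites at depth \<open>M\<close>.\<close>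

lemma site_box_covering_window:
  assumes side: "\<And>k. 2 * int M \<le> hi k - lo k" and p: "p \<in> site_box lo hi"
  obtains x where "x \<in> site_box lo hi" "window M x \<subseteq> site_box lo hi" "max_norm (p - x) \<le> real M"
    "\<And>w. w \<in> site_box lo hi \<Longrightarrow> w \<notin> window M x \<Longrightarrow> real M < max_norm (p - w)"
proof -
  obtain x where x: "\<And>k. coordinate x k = max (lo k + int M) (min (hi k - int M) (coordinate p k))"
    using obtain_site[of "\<lambda>k. max (lo k + int M) (min (hi k - int M) (coordinate p k))"] by metis
  have pk: "lo k \<le> coordinate p k" "coordinate p k \<le> hi k" for k
    using p by (auto simp: site_box_def)
  have win: "z \<in> window M x \<longleftrightarrow> (\<forall>k. \<bar>coordinate z k - coordinate x k\<bar> \<le> int M)" for z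
    unfolding window_iff max_norm_le_iff coordinate_diff
    by (metis of_int_abs of_int_le_iff of_int_of_nat_eq)
  show ?thesis
  proof
    show "x \<in> site_box lo hi" unfolding site_box_def mem_Collect_eq
    proof
      fix k show "lo k \<le> coordinate x k \<and> coordinate x k \<le> hi k"
        using side[of k] unfolding x by linarith
    qed
    show "window M x \<subseteq> site_box lo hi"
    proof
      fix z assume "z \<in> window M x"
      then have z: "\<bar>coordinate z k - coordinate x k\<bar> \<le> int M" for k by (simp add: win)
      show "z \<in> site_box lo hi" unfolding site_box_def mem_Collect_eq
      proof
        fix k show "lo k \<le> coordinate z k \<and> coordinate z k \<le> hi k"
          using side[of k] z[of k] unfolding x by linarith
      qed
    qed
    have "p \<in> window M x" unfolding win
    proof
      fix k show "\<bar>coordinate p k - coordinate x k\<bar> \<le> int M"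
        using side[of k] pk[of k] unfolding x by linarith
    qed
    then show "max_norm (p - x) \<le> real M" by (simp add: window_iff)
    fix w assume w: "w \<in> site_box lo hi" "w \<notin> window M x"
    then obtain k where k: "\<bar>coordinate w k - coordinate x k\<bar> > int M"
      unfolding win not_all not_le by blast
    have "lo k \<le> coordinate w k" "coordinate w k \<le> hi k" using w by (auto simp: site_box_def)
    \<comment> \<open>If the projection moves coordinate \<open>k\<close>, the window reaches the
      face of the box next to \<open>p\<close>. Then \<open>w\<close> can only leave it on the
      opposite side, which is even farther from \<open>p\<close> than from the centre.\<close>
    then have "int M < \<bar>coordinate (p - w) k\<bar>"
      using k pk[of k] side[of k] unfolding x coordinate_diff by linarith
    then have "real M < \<bar>real_of_int (coordinate (p - w) k)\<bar>" by linarith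
    then show "real M < max_norm (p - w)" using coordinate_le_max_norm[of "p - w" k] by linarith
  qed
qed

text \<open>The maximum of 0 and the cones \<open>B - s * max_norm (x - a) powr c\<close> with tips
  in \<open>S\<close>. Because \<open>c < 1\<close>, the power of \<open>max_norm\<close> still
  satisfies the triangle inequality, so the cones and their maximum are Lipschitz for it. The value
  0 also covers empty \<open>S\<close>.\<close>

lemma bump_function:
  fixes S :: "('b::finite, 'd::finite) site set" and B s c :: real
  assumes fin: "finite S" and B: "B \<ge> 0" and s: "s \<ge> 0" and c: "0 < c" "c < 1"
  obtains h where "\<And>x. 0 \<le> h x" "\<And>x. h x \<le> B"
    "\<And>x a. a \<in> S \<Longrightarrow> B - s * max_norm (x - a) powr c \<le> h x"
    "\<And>x. 0 < h x \<Longrightarrow> \<exists>a\<in>S. s * max_norm (x - a) powr c < B"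
    "\<And>x y. h y - h x \<le> s * max_norm (x - y) powr c"
proof -
  define f where "f = (\<lambda>(x :: ('b, 'd) site) a. B - s * max_norm (x - a) powr c)"
  define h where "h = (\<lambda>x. Max (insert 0 (f x ` S)))"
  have ge0: "0 \<le> h x" for x unfolding h_def using fin by (intro Max_ge) auto
  have gef: "f x a \<le> h x" if "a \<in> S" for x a unfolding h_def using fin that by (intro Max_ge) auto
  have att: "h x = 0 \<or> (\<exists>a\<in>S. h x = f x a)" for x
    using Max_in[of "insert 0 (f x ` S)"] fin unfolding h_def by auto
  have leB: "h x \<le> B" for x
    using att[of x] B s by (auto simp: f_def)
  have pos: "\<exists>a\<in>S. s * max_norm (x - a) powr c < B" if "0 < h x" for x
    using att[of x] that by (auto simp: f_def)
  have lip: "h y - h x \<le> s * max_norm (x - y) powr c" for x y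
  proof (cases "h y = 0")
    case True
    have "0 \<le> s * max_norm (x - y) powr c" using s by simp
    then show ?thesis using True ge0[of x] by linarith
  next
    case False
    then obtain a where a: "a \<in> S" "h y = f y a" using att[of y] by auto
    have "max_norm (x - a) powr c \<le> (max_norm (x - y) + max_norm (y - a)) powr c"
      using c by (intro powr_mono2 max_norm_dist_triangle) auto
    also have "\<dots> \<le> max_norm (x - y) powr c + max_norm (y - a) powr c"
      using c by (intro powr_subadditive) auto
    finally have "s * max_norm (x - a) powr c \<le> s * (max_norm (x - y) powr c + max_norm (y - a) powr c)"
      using s by (rule mult_left_mono)
    then show ?thesis using gef[OF a(1), of x] a(2) by (simp add: f_def algebra_simps)
  qed
  show ?thesis
    by (rule that[of h]) (use ge0 leB gef pos lip in \<open>auto simp: f_def\<close>)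
qed

section \<open>The weighted estimate\<close>

text \<open>\<open>K\<close> bounds the loss of a window, \<open>P\<close> the size of
  \<open>\<psi>\<close> around a component, and \<open>B\<close> is the height of the bump. Of the
  gain \<open>2 * s * min (max_norm x) a powr c\<close>, one half pays for a good step by
  \<open>good\<close>, the other for the variation of the bump. By \<open>bad\<close> the height
  pays for the large norm around a component, and \<open>B \<le> s * (R / 4) powr c\<close> confines
  the bump to distance \<open>R / 4\<close> from the components.\<close>

lemma weighted_decay_estimate:
  fixes T :: "('b::finite, 'd::finite) site \<Rightarrow> ('b, 'd) site \<Rightarrow> complex"
    and \<psi> :: "('b, 'd) site \<Rightarrow> real"
  assumes \<alpha>: "\<alpha> > 1" and c: "c = 1 / \<alpha>" and L: "L > 0" and s: "s \<ge> 0"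
    and T: "\<And>x x'. x \<noteq> x' \<Longrightarrow> cmod (T x x') < exp (- L * alpha_norm \<alpha> (x - x'))"
    and box: "\<Omega> = site_box lo hi" and fin: "finite \<Omega>" and side: "\<And>k. 2 * int M \<le> hi k - lo k"
    and cover: "\<Omega> = \<Omega>\<^sub>0 \<union> \<Union>\<C>"
    and inv0: "\<And>x. x \<in> \<Omega>\<^sub>0 \<Longrightarrow> invertible_on (window M x) T"
    and norm0: "\<And>x. x \<in> \<Omega>\<^sub>0 \<Longrightarrow> op_norm_on (window M x) (green T (window M x)) \<le> exp \<kappa>\<^sub>0"
    and decay0: "\<And>x p q. x \<in> \<Omega>\<^sub>0 \<Longrightarrow> p \<in> window M x \<Longrightarrow> q \<in> window M x \<Longrightarrow> max_norm (p - q) > \<rho> \<Longrightarrow>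
        cmod (green T (window M x) p q) < exp (- L * alpha_norm \<alpha> (p - q))"
    and diam: "\<And>A x y. A \<in> \<C> \<Longrightarrow> x \<in> A \<Longrightarrow> y \<in> A \<Longrightarrow> max_norm (x - y) \<le> D"
    and sep: "\<And>A A' x y. A \<in> \<C> \<Longrightarrow> A' \<in> \<C> \<Longrightarrow> A \<noteq> A' \<Longrightarrow> x \<in> A \<Longrightarrow> y \<in> A' \<Longrightarrow> 2 * R < max_norm (x - y)"
    and inv1: "\<And>A. A \<in> \<C> \<Longrightarrow> invertible_on (nbhd_in \<Omega> R A) T"
    and norm1: "\<And>A. A \<in> \<C> \<Longrightarrow> op_norm_on (nbhd_in \<Omega> R A) (green T (nbhd_in \<Omega> R A)) \<le> exp \<kappa>\<^sub>1"
    and \<psi>_triangle: "\<And>x y. \<psi> (x + y) \<le> \<psi> x + \<psi> y"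
    and \<psi>_gain: "\<And>x. \<psi> x \<le> L * alpha_norm \<alpha> x - 2 * s * min (max_norm x) a powr c"
    and \<psi>_local: "\<And>x. max_norm x \<le> D + 2 * R \<Longrightarrow> \<psi> x \<le> P"
    and K: "\<kappa>\<^sub>0 + L * (real (CARD('b) + CARD('d)) * \<rho> powr c) \<le> K" "0 \<le> K"
    and \<Lambda>: "2 * (real (card \<Omega>))\<^sup>2 \<le> exp \<Lambda>"
    and good: "K + \<Lambda> \<le> s * real M powr c"
    and scales: "real M \<le> a" "R / 4 \<le> a" "real M \<le> R / 2"
    and B: "0 \<le> B" "B \<le> s * (R / 4) powr c"
    and bad: "\<kappa>\<^sub>1 + P + \<Lambda> + s * real M powr c \<le> B" and P: "0 \<le> P" and \<kappa>\<^sub>1: "0 \<le> \<kappa>\<^sub>1"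
    and eq: "\<And>p. p \<in> \<Omega> \<Longrightarrow> (\<Sum>q\<in>\<Omega>. T p q * u q) = (if p = y then \<tau> else 0)"
    and x: "x \<in> \<Omega>"
  shows "cmod (u x) \<le> 2 * exp (K + \<kappa>\<^sub>1 + P + B - \<psi> (x - y)) * cmod \<tau>"
proof -
  have c01: "0 < c" "c < 1" using \<alpha> c by auto
  have R: "0 \<le> R" using scales(3) by linarith
  have \<psi>_le: "\<psi> z \<le> L * alpha_norm \<alpha> z" for z
  proof -
    have "0 \<le> 2 * s * min (max_norm z) a powr c" using s by simp
    then show ?thesis using \<psi>_gain[of z] by linarith
  qed
  have tri: "L * alpha_norm \<alpha> (p - r) \<le> L * alpha_norm \<alpha> (p - q) + L * alpha_norm \<alpha> (q - r)" for p q r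
  proof -
    have "alpha_norm \<alpha> (p - r) \<le> alpha_norm \<alpha> (p - q) + alpha_norm \<alpha> (q - r)"
      using alpha_norm_triangle[OF \<alpha>, of "p - q" "q - r"] by simp
    then have "L * alpha_norm \<alpha> (p - r) \<le> L * (alpha_norm \<alpha> (p - q) + alpha_norm \<alpha> (q - r))"
      using L by (intro mult_left_mono) auto
    then show ?thesis by (simp add: distrib_left)
  qed
  have \<psi>_tri: "\<psi> (p - r) \<le> \<psi> (p - q) + \<psi> (q - r)" for p q r
    using \<psi>_triangle[of "p - q" "q - r"] by simp
  have T_le: "cmod (T p q) \<le> exp (- (L * alpha_norm \<alpha> (p - q)))" if "p \<noteq> q" for p q
    using T[OF that] by simp
  have fin1: "finite (\<Union>\<C>)" using fin cover by (metis finite_Un)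
  obtain h where h: "\<And>x. 0 \<le> h x" "\<And>x. h x \<le> B"
    "\<And>x a. a \<in> \<Union>\<C> \<Longrightarrow> B - s * max_norm (x - a) powr c \<le> h x"
    "\<And>x. 0 < h x \<Longrightarrow> \<exists>a\<in>\<Union>\<C>. s * max_norm (x - a) powr c < B"
    "\<And>x y. h y - h x \<le> s * max_norm (x - y) powr c"
    by (rule bump_function[OF fin1 B(1) s c01], rule that)
  define H where "H = (\<lambda>x. h x - \<psi> (x - y))"
  have "cmod (u x) \<le> 2 * exp (K + \<kappa>\<^sub>1 + P) * cmod \<tau> * exp (H x)"
  proof (rule weighted_maximum_principle[OF fin _ eq \<Lambda> _ x])
    fix x assume x: "x \<in> \<Omega>"
    \<comment> \<open>The patch at \<open>x\<close> is decided by the centre \<open>x'\<close> of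
      its window, not by \<open>x\<close> itself: \<open>x\<close> may lie in the good set while
      \<open>x'\<close> does not.\<close>
    obtain x' where x': "x' \<in> \<Omega>" "window M x' \<subseteq> \<Omega>" "max_norm (x - x') \<le> real M"
      "\<And>w. w \<in> \<Omega> \<Longrightarrow> w \<notin> window M x' \<Longrightarrow> real M < max_norm (x - w)"
      by (rule site_box_covering_window[where lo = lo and hi = hi, OF side, folded box, OF x], rule that)
    show "\<exists>K' V G. x \<in> K' \<and> K' \<subseteq> V \<and> V \<subseteq> \<Omega> \<and> inverse_on V T G \<and>
       (y \<in> K' \<longrightarrow> cmod (G x y) \<le> exp (K + \<kappa>\<^sub>1 + P) * exp (H x)) \<and>
       (\<forall>p\<in>V. \<forall>q\<in>\<Omega>. (p \<in> K') \<noteq> (q \<in> K') \<longrightarrow>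
          cmod (G x p) * cmod (T p q) \<le> exp (H x - H q - \<Lambda>))"
    proof (cases "x' \<in> \<Omega>\<^sub>0")
      case True
      define V where "V = window M x'"
      define G where "G = green T V"
      have finV: "finite V" using finite_subset[OF x'(2) fin] by (simp add: V_def)
      have invG: "inverse_on V T G"
        unfolding G_def using finV inv0[OF True] by (intro inverse_on_green) (auto simp: V_def)
      have xV: "x \<in> V" using x'(3) by (simp add: V_def window_iff)
      \<comment> \<open>Up to distance \<open>\<rho>\<close> only the norm controls the entry;
        giving that bound the decaying form costs the second summand in \<open>K(1)\<close>.\<close>
      have Gxp: "cmod (G x p) \<le> exp (K - L * alpha_norm \<alpha> (x - p))" if p: "p \<in> V" for p
      proof (cases "max_norm (x - p) > \<rho>")
        case far: True
        have "cmod (G x p) < exp (- L * alpha_norm \<alpha> (x - p))"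
          using decay0[OF True, of x p] far p xV by (simp add: V_def G_def)
        also have "\<dots> \<le> exp (K - L * alpha_norm \<alpha> (x - p))" using K(2) by simp
        finally show ?thesis by simp
      next
        case False
        have "cmod (G x p) \<le> exp \<kappa>\<^sub>0"
          using entry_le_op_norm_on[OF finV xV p, of G] norm0[OF True] by (simp add: G_def V_def)
        moreover have "L * alpha_norm \<alpha> (x - p) \<le> L * (real (CARD('b) + CARD('d)) * \<rho> powr c)"
          unfolding c using False L \<alpha> by (intro mult_left_mono alpha_norm_le) auto
        then have "exp \<kappa>\<^sub>0 \<le> exp (K - L * alpha_norm \<alpha> (x - p))" using K(1) by simp
        ultimately show ?thesis by linarith
      qed
      show ?thesis
      proof (intro exI[of _ V] exI[of _ G] conjI ballI impI)
        show "V \<subseteq> \<Omega>" using x'(2) by (simp add: V_def)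
        assume "y \<in> V"
        have "cmod (G x y) \<le> exp (K - L * alpha_norm \<alpha> (x - y))" by (rule Gxp) fact
        also have "\<dots> \<le> exp (K + \<kappa>\<^sub>1 + P + H x)"
          using \<psi>_le[of "x - y"] h(1)[of x] P \<kappa>\<^sub>1 by (simp add: H_def)
        finally show "cmod (G x y) \<le> exp (K + \<kappa>\<^sub>1 + P) * exp (H x)" by (simp add: exp_add)
      next
        fix p q assume p: "p \<in> V" and q: "q \<in> \<Omega>" and pq: "(p \<in> V) \<noteq> (q \<in> V)"
        have qV: "q \<notin> V" using p pq by simp
        then have "p \<noteq> q" using p by auto
        define m where "m = s * min (max_norm (x - q)) a powr c"
        have "real M < max_norm (x - q)" using x'(4)[OF q] qV by (simp add: V_def)
        then have "real M powr c \<le> min (max_norm (x - q)) a powr c"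
          using scales(1) c01 by (intro powr_mono2) auto
        then have m1: "s * real M powr c \<le> m" unfolding m_def using s by (intro mult_left_mono)
        have "s * (R / 4) powr c \<le> s * a powr c"
          using s scales R c01 by (intro mult_left_mono powr_mono2) auto
        \<comment> \<open>Up to distance \<open>a\<close> the Lipschitz bound on the bump is used,
          beyond it the full height \<open>B\<close>.\<close>
        then have m2: "h q - h x \<le> m"
          using h(5)[of q x] h(1)[of x] h(2)[of q] B(2) by (auto simp: m_def min_def)
        have "cmod (G x p) * cmod (T p q)
            \<le> exp (K - L * alpha_norm \<alpha> (x - p)) * exp (- (L * alpha_norm \<alpha> (p - q)))"
          by (intro mult_mono Gxp p T_le \<open>p \<noteq> q\<close>) auto
        also have "\<dots> = exp (K - L * alpha_norm \<alpha> (x - p) - L * alpha_norm \<alpha> (p - q))"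
          by (simp flip: exp_add)
        also have "\<dots> \<le> exp (K - L * alpha_norm \<alpha> (x - q))"
          using tri[of x q p] by simp
        also have "\<dots> \<le> exp (H x - H q - \<Lambda>)"
          using \<psi>_gain[of "x - q"] \<psi>_tri[of x y q] m1 m2 good by (simp add: H_def m_def)
        finally show "cmod (G x p) * cmod (T p q) \<le> exp (H x - H q - \<Lambda>)" .
      qed (use xV invG in auto)
    next
      case False
      then obtain A where A: "A \<in> \<C>" "x' \<in> A" using x'(1) cover by auto
      define V where "V = nbhd_in \<Omega> R A"
      define K' where "K' = nbhd_in \<Omega> (R / 2) A"
      define G where "G = green T V"
      have K'V: "K' \<subseteq> V" using R by (force simp: K'_def V_def nbhd_in_def)
      have V\<Omega>: "V \<subseteq> \<Omega>" by (auto simp: V_def nbhd_in_def)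
      have xK': "x \<in> K'" using x x'(3) A scales(3) by (force simp: K'_def nbhd_in_def)
      have finV: "finite V" by (rule finite_subset[OF V\<Omega> fin])
      have invG: "inverse_on V T G"
        unfolding G_def using finV inv1[OF A(1)] by (intro inverse_on_green) (auto simp: V_def)
      have Gxp: "cmod (G x p) \<le> exp \<kappa>\<^sub>1" if "p \<in> V" for p
        using entry_le_op_norm_on[OF finV _ that, of x G] xK' K'V norm1[OF A(1)]
        by (auto simp: G_def V_def)
      have \<psi>xp: "\<psi> (x - p) \<le> P" if p: "p \<in> V" for p
      proof (rule \<psi>_local)
        from p obtain b where b: "b \<in> A" "max_norm (p - b) \<le> R" by (auto simp: V_def nbhd_in_def)
        show "max_norm (x - p) \<le> D + 2 * R"
          using max_norm_dist_triangle[of x p x'] max_norm_dist_triangle[of x' p b]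
            max_norm_minus_commute[of p b] diam[OF A b(1)] b(2) x'(3) scales(3) R by linarith
      qed
      have "s * max_norm (x - x') powr c \<le> s * real M powr c"
        using s x'(3) c01 by (intro mult_left_mono powr_mono2) auto
      then have hx: "B - s * real M powr c \<le> h x" using h(3)[of x' x] A by force
      show ?thesis
      proof (rule exI[of _ K'], rule exI[of _ V], rule exI[of _ G], intro conjI ballI impI)
        assume "y \<in> K'"
        then have y: "y \<in> V" using K'V by auto
        have "cmod (G x y) \<le> exp \<kappa>\<^sub>1" by (rule Gxp[OF y])
        also have "\<dots> \<le> exp (K + \<kappa>\<^sub>1 + P + H x)"
          using \<psi>xp[OF y] h(1)[of x] K(2) by (simp add: H_def)
        finally show "cmod (G x y) \<le> exp (K + \<kappa>\<^sub>1 + P) * exp (H x)" by (simp add: exp_add)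
      next
        fix p q assume p: "p \<in> V" and q: "q \<in> \<Omega>" and pq: "(p \<in> K') \<noteq> (q \<in> K')"
        then have "p \<noteq> q" by auto
        define m where "m = s * min (max_norm (p - q)) a powr c"
        have m0: "0 \<le> m" using s by (simp add: m_def)
        \<comment> \<open>Commutator pairs that reach the bump are long. A site \<open>q\<close>
          with \<open>h q > 0\<close> is within \<open>R / 4\<close> of a component. If that is
          \<open>A\<close>, then \<open>q\<close> lies in \<open>K'\<close> and \<open>p\<close> is
          farther than \<open>R / 2\<close> from \<open>A\<close>; otherwise \<open>p\<close> lies
          in \<open>K'\<close> and the separation \<open>2 * R\<close> keeps it away from
          \<open>q\<close>.\<close>
        have far: "R / 4 \<le> max_norm (p - q)" if "0 < h q"
        proof -
          from h(4)[OF that] obtain b A' where b: "A' \<in> \<C>" "b \<in> A'" "s * max_norm (q - b) powr c < B"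
            by blast
          have qb: "max_norm (q - b) < R / 4"
          proof (rule ccontr)
            assume "\<not> ?thesis"
            then have "s * (R / 4) powr c \<le> s * max_norm (q - b) powr c"
              using s R c01 by (intro mult_left_mono powr_mono2) auto
            then show False using b(3) B(2) by linarith
          qed
          show ?thesis
          proof (cases "A' = A")
            case True
            have "q \<in> K'" using q b(2) qb R True by (force simp: K'_def nbhd_in_def)
            then have "p \<notin> K'" using pq by simp
            then have "R / 2 < max_norm (p - b)"
              using p b(2) True by (force simp: K'_def V_def nbhd_in_def)
            then show ?thesis using qb max_norm_dist_triangle[of p b q] by linarith
          next
            case False
            have "q \<notin> K'"
            proof
              assume "q \<in> K'"
              then obtain b' where b': "b' \<in> A" "max_norm (q - b') \<le> R / 2"
                by (auto simp: K'_def nbhd_in_def)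
              then show False
                using sep[OF b(1) A(1) False b(2) b'(1)] max_norm_dist_triangle[of b b' q]
                  max_norm_minus_commute[of b q] qb R by linarith
            qed
            then obtain b' where b': "b' \<in> A" "max_norm (p - b') \<le> R / 2"
              using pq by (auto simp: K'_def nbhd_in_def)
            then show ?thesis
              using sep[OF b(1) A(1) False b(2) b'(1)] max_norm_dist_triangle[of b b' q]
                max_norm_dist_triangle[of q b' p] max_norm_minus_commute[of b q]
                max_norm_minus_commute[of q p] qb R by linarith
          qed
        qed
        have m: "h q \<le> m"
        proof (cases "0 < h q")
          case True
          have "(R / 4) powr c \<le> min (max_norm (p - q)) a powr c"
            using far[OF True] scales(2) R c01 by (intro powr_mono2) auto
          then have "s * (R / 4) powr c \<le> m" unfolding m_def using s by (intro mult_left_mono)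
          then show ?thesis using h(2)[of q] B(2) by linarith
        qed (use m0 in linarith)
        have "cmod (G x p) * cmod (T p q) \<le> exp \<kappa>\<^sub>1 * exp (- (L * alpha_norm \<alpha> (p - q)))"
          by (intro mult_mono Gxp p T_le \<open>p \<noteq> q\<close>) auto
        also have "\<dots> = exp (\<kappa>\<^sub>1 - L * alpha_norm \<alpha> (p - q))" by (simp flip: exp_add)
        \<comment> \<open>No decay of \<open>G\<close> is available here, so the weight is compared
          along \<open>x\<close>, \<open>p\<close>, \<open>q\<close>: the first leg costs at most
          \<open>P\<close>, and the gain on the second covers \<open>h q\<close>.\<close>
        also have "\<dots> \<le> exp (H x - H q - \<Lambda>)"
          using \<psi>_gain[of "p - q"] \<psi>_tri[of x y q] \<psi>_tri[of x q p] \<psi>xp[OF p] hx m m0 bad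
          by (simp add: H_def m_def)
        finally show "cmod (G x p) * cmod (T p q) \<le> exp (H x - H q - \<Lambda>)" .
      qed (use xK' K'V V\<Omega> invG in auto)
    qed
  qed simp
  also have "\<dots> = 2 * exp (K + \<kappa>\<^sub>1 + P + H x) * cmod \<tau>" by (simp add: exp_add)
  also have "\<dots> \<le> 2 * exp (K + \<kappa>\<^sub>1 + P + B - \<psi> (x - y)) * cmod \<tau>"
    using h(2)[of x] by (intro mult_right_mono mult_left_mono) (auto simp: H_def)
  finally show ?thesis .
qed

section \<open>Asymptotics of the scales\<close>

lemma powr_dominated:
  fixes p q \<eta> C :: real
  assumes "p < q" "\<eta> > 0"
  shows "eventually (\<lambda>x. C * x powr p \<le> \<eta> * x powr q) at_top"
proof -
  have "((\<lambda>x::real. C * x powr (p - q)) \<longlongrightarrow> C * 0) at_top"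
    using assms by (intro tendsto_intros tendsto_neg_powr filterlim_ident) auto
  then have "eventually (\<lambda>x. C * x powr (p - q) < \<eta>) at_top"
    using assms by (intro order_tendstoD) auto
  then show ?thesis using eventually_gt_at_top[of 0]
  proof eventually_elim
    case (elim x)
    have "C * x powr (p - q) * x powr q \<le> \<eta> * x powr q"
      using elim by (intro mult_right_mono) auto
    also have "C * x powr (p - q) * x powr q = C * x powr p"
      by (simp add: mult.assoc flip: powr_add)
    finally show ?case .
  qed
qed

lemma powr_sum_dominated:
  fixes p1 p2 p3 q C1 C2 C3 :: real
  assumes "p1 < q" "p2 < q" "p3 < q"
  shows "eventually (\<lambda>x. C1 * x powr p1 + C2 * x powr p2 + C3 * x powr p3 < x powr q) at_top"
proof -
  have quarter: "(1 / 4 :: real) > 0" by simp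
  show ?thesis
    using powr_dominated[OF assms(1) quarter, of C1] powr_dominated[OF assms(2) quarter, of C2]
      powr_dominated[OF assms(3) quarter, of C3] eventually_gt_at_top[of 0]
  proof eventually_elim
    case (elim x)
    then have "x powr q > 0" by simp
    then show ?case using elim(1-3) by linarith
  qed
qed

text \<open>Large \<open>M\<^sub>0\<close> with \<open>M\<^sub>1\<close> tied to it. As a filter, it
  lets the many thresholds be combined by eventuality, and membership unfolds to one bound on
  \<open>M\<^sub>0\<close> that is uniform in \<open>M\<^sub>1\<close>.\<close>

definition scale_filter :: "real \<Rightarrow> real \<Rightarrow> (nat \<times> nat) filter" where
  "scale_filter \<iota> \<iota>' = inf (filtercomap fst at_top) (principal {(M\<^sub>0, M\<^sub>1). M\<^sub>1 > 0 \<and>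
     ln (real M\<^sub>0) powr \<iota>' \<le> ln (ln (real M\<^sub>1)) \<and> ln (ln (real M\<^sub>1)) \<le> \<iota> * ln (real M\<^sub>0)})"

lemma eventually_scale_filterD:
  assumes "eventually P (scale_filter \<iota> \<iota>')"
  obtains N where "\<And>M\<^sub>0 M\<^sub>1. M\<^sub>0 > N \<Longrightarrow> M\<^sub>1 > 0 \<Longrightarrow> ln (real M\<^sub>0) powr \<iota>' \<le> ln (ln (real M\<^sub>1)) \<Longrightarrow>
    ln (ln (real M\<^sub>1)) \<le> \<iota> * ln (real M\<^sub>0) \<Longrightarrow> P (M\<^sub>0, M\<^sub>1)"
  using assms unfolding scale_filter_def eventually_inf_principal eventually_filtercomap_at_top_dense
  by auto

lemma filterlim_scale_fst: "filterlim (\<lambda>M. real (fst M)) at_top (scale_filter \<iota> \<iota>')"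
  unfolding scale_filter_def
  by (intro filterlim_compose[OF filterlim_real_sequentially] filterlim_mono[OF filterlim_filtercomap]) auto

lemma eventually_scale_ln:
  assumes "\<iota>' > 0"
  shows "eventually (\<lambda>M. ln (real (snd M)) > 0 \<and> ln (real (snd M)) \<le> real (fst M) powr \<iota> \<and>
    exp (ln (real (fst M)) powr \<iota>') \<le> ln (real (snd M))) (scale_filter \<iota> \<iota>')"
proof -
  have "eventually (\<lambda>M. real (fst M) > 1) (scale_filter \<iota> \<iota>')"
    using filterlim_scale_fst by (rule filterlim_at_top_dense[THEN iffD1, rule_format])
  moreover have "eventually (\<lambda>M. snd M > 0 \<and> ln (real (fst M)) powr \<iota>' \<le> ln (ln (real (snd M))) \<and>
      ln (ln (real (snd M))) \<le> \<iota> * ln (real (fst M))) (scale_filter \<iota> \<iota>')"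
    unfolding scale_filter_def by (simp add: eventually_inf_principal case_prod_unfold)
  ultimately show ?thesis
  proof eventually_elim
    case (elim M)
    have "ln (real (fst M)) powr \<iota>' > 0" using elim by simp
    then have "ln (ln (real (snd M))) \<noteq> 0" using elim by linarith
    \<comment> \<open>The default value \<open>ln 0 = 0\<close> matters: for
      \<open>snd M = 1\<close> the double logarithm would be 0, which was just excluded.\<close>
    then have "ln (real (snd M)) \<noteq> 0" by (metis ln_0)
    moreover have "ln (real (snd M)) \<ge> 0" using elim by simp
    ultimately have pos: "ln (real (snd M)) > 0" by linarith
    have "ln (real (snd M)) \<le> exp (\<iota> * ln (real (fst M)))"
      using elim pos by (metis exp_ln exp_le_cancel_iff)
    moreover have "exp (ln (real (fst M)) powr \<iota>') \<le> ln (real (snd M))"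
      using elim pos by (metis exp_ln exp_le_cancel_iff)
    ultimately show ?case using pos elim(1) by (simp add: powr_def)
  qed
qed

lemma filterlim_powr_at_top:
  assumes "p > 0"
  shows "filterlim (\<lambda>x::real. x powr p) at_top at_top"
  unfolding filterlim_at_top
proof
  fix Z :: real
  show "eventually (\<lambda>x. Z \<le> x powr p) at_top"
    using powr_dominated[OF assms zero_less_one, of Z] eventually_gt_at_top[of 0]
    by eventually_elim simp_all
qed

text \<open>For an integer \<open>k\<close> with \<open>p * k > 1\<close>, the exponential beats the
  \<open>k\<close>-th power of \<open>y powr p\<close>, which beats any multiple of
  \<open>y\<close>.\<close>

lemma eventually_linear_le_exp_powr:
  fixes A p :: real
  assumes "p > 0"
  shows "eventually (\<lambda>y. A * y \<le> exp (y powr p)) at_top"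
proof -
  obtain k :: nat where k: "real k > 1 / p" using reals_Archimedean2 by blast
  have pk: "1 < p * real k" using k assms by (simp add: field_simps)
  have "((\<lambda>y::real. (y powr p) ^ k / exp (y powr p)) \<longlongrightarrow> 0) at_top"
    using filterlim_compose[OF tendsto_power_div_exp_0 filterlim_powr_at_top[OF assms]] .
  then have "eventually (\<lambda>y::real. (y powr p) ^ k / exp (y powr p) < 1) at_top"
    by (intro order_tendstoD) auto
  then show ?thesis
    using powr_dominated[OF pk zero_less_one, of A] eventually_gt_at_top[of 0]
  proof eventually_elim
    case (elim y)
    have "A * y \<le> y powr (p * real k)" using elim by simp
    also have "\<dots> = (y powr p) ^ k" using elim by (simp add: powr_realpow flip: powr_powr)
    also have "\<dots> \<le> exp (y powr p)" using elim(1) by (simp add: divide_less_eq)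
    finally show ?case .
  qed
qed

text \<open>The lower bound on the double logarithm puts \<open>ln M\<^sub>1\<close> above
  \<open>exp (ln M\<^sub>0 powr \<iota>')\<close>, which exceeds every multiple of
  \<open>ln M\<^sub>0\<close>.\<close>

lemma eventually_scale_powr_le:
  assumes "\<iota>' > 0" "\<sigma> > 0"
  shows "eventually (\<lambda>M. real (fst M) powr a \<le> real (snd M) powr \<sigma>) (scale_filter \<iota> \<iota>')"
proof -
  have "filterlim (\<lambda>M. ln (real (fst M))) at_top (scale_filter \<iota> \<iota>')"
    using filterlim_compose[OF ln_at_top filterlim_scale_fst] .
  from eventually_compose_filterlim[OF eventually_linear_le_exp_powr[OF assms(1), of "a / \<sigma>"] this]
  have "eventually (\<lambda>M. a / \<sigma> * ln (real (fst M)) \<le> exp (ln (real (fst M)) powr \<iota>')) (scale_filter \<iota> \<iota>')" .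
  moreover have "eventually (\<lambda>M. real (fst M) > 1) (scale_filter \<iota> \<iota>')"
    using filterlim_scale_fst by (rule filterlim_at_top_dense[THEN iffD1, rule_format])
  ultimately show ?thesis using eventually_scale_ln[OF assms(1), of \<iota>]
  proof eventually_elim
    case (elim M)
    then have "a / \<sigma> * ln (real (fst M)) \<le> ln (real (snd M))" by linarith
    then have "a * ln (real (fst M)) \<le> \<sigma> * ln (real (snd M))"
      using assms(2) by (simp add: field_simps)
    moreover have "snd M \<noteq> 0" using elim by (metis less_irrefl ln_0 of_nat_0)
    ultimately show ?case using elim(2) by (simp add: powr_def)
  qed
qed

lemma filterlim_scale_snd:
  assumes "\<iota>' > 0"
  shows "filterlim (\<lambda>M. real (snd M)) at_top (scale_filter \<iota> \<iota>')"
proof (rule filterlim_at_top_mono[OF filterlim_scale_fst])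
  have "eventually (\<lambda>M. real (fst M) > 0) (scale_filter \<iota> \<iota>')"
    using filterlim_scale_fst by (rule filterlim_at_top_dense[THEN iffD1, rule_format])
  with eventually_scale_powr_le[OF assms zero_less_one, of 1 \<iota>]
  show "eventually (\<lambda>M. real (fst M) \<le> real (snd M)) (scale_filter \<iota> \<iota>')"
    by eventually_elim simp_all
qed

lemma max_norm_le_set_diam:
  assumes "x \<in> A" "y \<in> A"
  shows "ereal (max_norm (x - y)) \<le> set_diam A"
  unfolding set_diam_def using assms by (intro SUP_upper2[of "(x, y)"]) auto

lemma set_dist_le_max_norm:
  assumes "x \<in> A" "y \<in> B"
  shows "set_dist A B \<le> ereal (max_norm (x - y))"
  unfolding set_dist_def using assms by (intro INF_lower2[of "(x, y)"]) auto

theorem lemma6p1: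
  fixes \<alpha> c L \<iota> \<iota>' \<kappa> \<theta> \<theta>\<^sub>1 \<theta>\<^sub>2 \<theta>\<^sub>3 \<theta>\<^sub>4 \<delta> \<epsilon> :: real
  assumes "\<alpha> > 1" and "c = 1 / \<alpha>" and "L > 0"
    and "\<iota> < c" and "\<iota>' > 0" and "\<kappa> < c"
    and "0 < \<theta>\<^sub>4" and "\<theta>\<^sub>4 < \<theta>\<^sub>3" and "\<theta>\<^sub>3 < \<theta>\<^sub>2" and "\<theta>\<^sub>2 < \<theta>\<^sub>1" and "\<theta>\<^sub>1 < \<theta>" and "\<theta> < 1"
    and "c > \<theta>\<^sub>4 / \<theta>\<^sub>3" and "\<delta> > 0" and "c < (\<theta> - \<theta>\<^sub>1 - \<delta>) / (1 - \<theta>\<^sub>3)"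
    and "\<epsilon> > 0"
  shows "\<exists>N :: nat. \<forall>(M\<^sub>0 :: nat) (M\<^sub>1 :: nat)
      (T :: ('b::finite, 'd::finite) site \<Rightarrow> ('b, 'd) site \<Rightarrow> complex)
      (Q :: (int ^ 'd) set) (\<Omega> :: ('b, 'd) site set) \<Omega>\<^sub>0 \<Omega>\<^sub>1 (\<C> :: ('b, 'd) site set set).
    M\<^sub>0 > N \<longrightarrow> M\<^sub>1 > 0 \<longrightarrow>
    ln (real M\<^sub>0) powr \<iota>' \<le> ln (ln (real M\<^sub>1)) \<longrightarrow>
    ln (ln (real M\<^sub>1)) \<le> \<iota> * ln (real M\<^sub>0) \<longrightarrow>
    (\<forall>x x'. x \<noteq> x' \<longrightarrow> cmod (T x x') < exp (- L * alpha_norm \<alpha> (x - x'))) \<longrightarrow>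
    cube_interval M\<^sub>1 Q \<longrightarrow>
    \<Omega> = int_box M\<^sub>1 \<times> Q \<longrightarrow>
    \<Omega> = \<Omega>\<^sub>0 \<union> \<Omega>\<^sub>1 \<longrightarrow>
    (\<forall>x\<in>\<Omega>\<^sub>0.
       invertible_on (window M\<^sub>0 x) T \<and>
       op_norm_on (window M\<^sub>0 x) (green T (window M\<^sub>0 x)) \<le> exp (real M\<^sub>0 powr \<kappa>) \<and>
       (\<forall>\<eta>\<in>window M\<^sub>0 x. \<forall>\<eta>'\<in>window M\<^sub>0 x. max_norm (\<eta> - \<eta>') > real M\<^sub>0 powr \<theta> \<longrightarrow>
          cmod (green T (window M\<^sub>0 x) \<eta> \<eta>') < exp (- L * alpha_norm \<alpha> (\<eta> - \<eta>')))) \<longrightarrow>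
    \<Omega>\<^sub>1 = \<Union>\<C> \<longrightarrow>
    (\<forall>A\<in>\<C>. set_diam A < ereal (real M\<^sub>1 powr \<theta>\<^sub>1)) \<longrightarrow>
    (\<forall>A\<in>\<C>. \<forall>B\<in>\<C>. A \<noteq> B \<longrightarrow> set_dist A B > ereal (real M\<^sub>1 powr \<theta>\<^sub>2)) \<longrightarrow>
    (\<forall>A\<in>\<C>.
       invertible_on (nbhd_in \<Omega> (real M\<^sub>1 powr \<theta>\<^sub>3) A) T \<and>
       op_norm_on (nbhd_in \<Omega> (real M\<^sub>1 powr \<theta>\<^sub>3) A) (green T (nbhd_in \<Omega> (real M\<^sub>1 powr \<theta>\<^sub>3) A))
         < exp (real M\<^sub>1 powr \<theta>\<^sub>4)) \<longrightarrow>
    invertible_on \<Omega> T \<and>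
    op_norm_on \<Omega> (green T \<Omega>) < exp (real M\<^sub>1 powr (\<theta>\<^sub>4 + \<epsilon>)) \<and>
    (\<forall>x\<in>\<Omega>. \<forall>y\<in>\<Omega>. max_norm (x - y) > real M\<^sub>1 powr \<theta> \<longrightarrow>
       cmod (green T \<Omega> x y)
         < exp (- (L - 2 * real M\<^sub>0 powr (max \<iota> (max \<kappa> (\<theta> * c)) - c)) * alpha_norm \<alpha> (x - y)))"
proof -

  \<comment> \<open>Choice of constants and exponents\<close>
  have c: "0 < c" "c < 1" using assms(1,2) by auto
  define n where "n = real (CARD('b) + CARD('d))"
  have n: "n > 0" unfolding n_def of_nat_0_less_iff by simp
  \<comment> \<open>Half of \<open>L\<close> times the constant in \<open>powr_add_gain\<close>,
    because the weighted estimate asks for a gain of \<open>2 * s\<close>.\<close>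
  define s where "s = L * (2 - 2 powr c) / 2"
  have s: "s > 0" using assms(3) two_powr_bounds[OF c] by (simp add: s_def)
  have two_s: "2 * s = L * (2 - 2 powr c)" by (simp add: s_def)
  have \<theta>\<^sub>3: "0 < \<theta>\<^sub>3" "\<theta>\<^sub>3 < 1" using assms by linarith+
  have "c * (1 - \<theta>\<^sub>3) < \<theta> - \<theta>\<^sub>1 - \<delta>" using assms(15) \<theta>\<^sub>3 by (simp add: pos_less_divide_eq)
  then have \<theta>\<delta>: "\<theta>\<^sub>1 + c - c * \<theta>\<^sub>3 < \<theta> - \<delta>" by (simp add: algebra_simps)
  have "c * \<theta>\<^sub>3 < c" using c \<theta>\<^sub>3 by simp
  then have \<theta>\<delta>1: "\<theta>\<^sub>1 < \<theta> - \<delta>" using \<theta>\<delta> by linarith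
  \<comment> \<open>The order of \<open>P\<close>: the diameter
    \<open>M\<^sub>1 powr \<theta>\<^sub>1\<close> times the slope \<open>a powr (c - 1)\<close> of
    the weight. The upper bound assumed on \<open>c\<close> puts this exponent below
    \<open>\<theta>\<^sub>3 * c\<close>.\<close>
  define \<theta>\<^sub>6 where "\<theta>\<^sub>6 = (\<theta> - \<delta>) * (c - 1) + \<theta>\<^sub>1"
  have "(\<theta> - \<delta>) * c < 1 * c" using assms c by (intro mult_strict_right_mono) linarith+
  then have \<theta>\<^sub>6: "\<theta>\<^sub>6 < \<theta>\<^sub>3 * c" using \<theta>\<delta> by (simp add: \<theta>\<^sub>6_def algebra_simps)
  have \<theta>\<^sub>4: "\<theta>\<^sub>4 < \<theta>\<^sub>3 * c" using assms(13) \<theta>\<^sub>3 by (simp add: pos_divide_less_eq mult.commute)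
  \<comment> \<open>Exponent of the bump height for the decay: it must beat the norm around a
    component and \<open>P\<close>, yet stay below what a bump of width \<open>R / 4\<close> can
    carry.\<close>
  obtain \<theta>\<^sub>5 where \<theta>\<^sub>5: "max \<theta>\<^sub>4 \<theta>\<^sub>6 < \<theta>\<^sub>5" "\<theta>\<^sub>5 < \<theta>\<^sub>3 * c"
    using dense[of "max \<theta>\<^sub>4 \<theta>\<^sub>6" "\<theta>\<^sub>3 * c"] \<theta>\<^sub>4 \<theta>\<^sub>6 by auto
  \<comment> \<open>Exponent of the bump height for the norm bound. There \<open>P = 0\<close>, so
    it may be taken as close to \<open>\<theta>\<^sub>4\<close> as \<open>\<epsilon>\<close>
    demands.\<close>
  obtain \<theta>\<^sub>5' where \<theta>\<^sub>5': "\<theta>\<^sub>4 < \<theta>\<^sub>5'" "\<theta>\<^sub>5' < min (\<theta>\<^sub>3 * c) (\<theta>\<^sub>4 + \<epsilon>)"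
    using dense[of \<theta>\<^sub>4 "min (\<theta>\<^sub>3 * c) (\<theta>\<^sub>4 + \<epsilon>)"] \<theta>\<^sub>4 assms(16) by auto
  have \<theta>c: "\<theta> * c < c" using assms(12) c by simp
  have "\<theta>\<^sub>3 * c < (\<theta> - \<delta> / 2) * c" using assms(9,10,14) \<theta>\<delta>1 c by (intro mult_strict_right_mono) linarith+
  then have \<theta>\<^sub>7: "\<theta>\<^sub>4 < (\<theta> - \<delta> / 2) * c" "\<theta>\<^sub>5 < (\<theta> - \<delta> / 2) * c"
    using \<theta>\<^sub>4 \<theta>\<^sub>5(2) by linarith+
  have \<theta>\<^sub>7': "(\<theta> - \<delta>) * c < (\<theta> - \<delta> / 2) * c"
    using assms(14) c by (intro mult_strict_right_mono) linarith+

  \<comment> \<open>Thresholds for the scales\<close>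
  note large = eventually_compose_filterlim[OF _ filterlim_scale_fst[of \<iota> \<iota>']]
    eventually_compose_filterlim[OF _ filterlim_scale_snd[OF assms(5), of \<iota>]]
  have s4: "s / 4 > 0" "s * (1 / 4) powr c > 0" using s by simp_all
  let ?F = "scale_filter \<iota> \<iota>'"
  have ev1: "\<forall>\<^sub>F M in ?F. real (fst M) > 3"
    by (rule large(1)[OF eventually_gt_at_top])
  \<comment> \<open>Each of the four parts of \<open>K + \<Lambda>\<close> receives a quarter of the
    gain \<open>s * M\<^sub>0 powr c\<close>. The third is the size of \<open>ln M\<^sub>1\<close>,
    where \<open>\<iota> < c\<close> enters; \<open>powr 0\<close> gives the constant part the same
    shape.\<close>
  have ev2: "\<forall>\<^sub>F M in ?F. 1 * real (fst M) powr \<kappa> \<le> s / 4 * real (fst M) powr c"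
    "\<forall>\<^sub>F M in ?F. L * n * real (fst M) powr (\<theta> * c) \<le> s / 4 * real (fst M) powr c"
    "\<forall>\<^sub>F M in ?F. 2 * n * real (fst M) powr \<iota> \<le> s / 4 * real (fst M) powr c"
    "\<forall>\<^sub>F M in ?F. (ln 2 + 2 * n * ln 3) * real (fst M) powr 0 \<le> s / 4 * real (fst M) powr c"
    by (rule large(1)[OF powr_dominated[OF _ s4(1)]], use assms c \<theta>c in simp)+
  note ev3 = eventually_scale_ln[OF assms(5), of \<iota>]
  have ev4: "\<forall>\<^sub>F M in ?F. real (fst M) powr 1 \<le> real (snd M) powr \<theta>\<^sub>4"
    "\<forall>\<^sub>F M in ?F. real (fst M) powr 2 \<le> real (snd M) powr 1"
    "\<forall>\<^sub>F M in ?F. real (fst M) powr c \<le> real (snd M) powr (\<delta> / 2 * c)"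
    by (rule eventually_scale_powr_le; use assms c in simp)+
  have ev5: "\<forall>\<^sub>F M in ?F. 2 * real (snd M) powr \<theta>\<^sub>4 \<le> 1 * real (snd M) powr \<theta>\<^sub>3"
    "\<forall>\<^sub>F M in ?F. 2 * real (snd M) powr \<theta>\<^sub>3 \<le> 1 * real (snd M) powr \<theta>\<^sub>2"
    by (rule large(2)[OF powr_dominated]; use assms in simp)+
  have ev6: "\<forall>\<^sub>F M in ?F. 1 * real (snd M) powr \<theta>\<^sub>5 \<le> s * (1 / 4) powr c * real (snd M) powr (\<theta>\<^sub>3 * c)"
    "\<forall>\<^sub>F M in ?F. 1 * real (snd M) powr \<theta>\<^sub>5' \<le> s * (1 / 4) powr c * real (snd M) powr (\<theta>\<^sub>3 * c)"
    by (rule large(2)[OF powr_dominated[OF _ s4(2)]], use \<theta>\<^sub>5 \<theta>\<^sub>5' in simp)+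
  \<comment> \<open>Zero coefficients pad the shorter sums to the three terms of
    \<open>powr_sum_dominated\<close>.\<close>
  have ev7: "\<forall>\<^sub>F M in ?F. (1 + 2 * s) * real (snd M) powr \<theta>\<^sub>4 + 3 * L * n * real (snd M) powr \<theta>\<^sub>6
       + 0 * real (snd M) powr \<theta>\<^sub>4 < real (snd M) powr \<theta>\<^sub>5"
    "\<forall>\<^sub>F M in ?F. (1 + 2 * s) * real (snd M) powr \<theta>\<^sub>4 + 0 * real (snd M) powr \<theta>\<^sub>4
       + 0 * real (snd M) powr \<theta>\<^sub>4 < real (snd M) powr \<theta>\<^sub>5'"
    "\<forall>\<^sub>F M in ?F. (1 + s) * real (snd M) powr \<theta>\<^sub>4 + 1 * real (snd M) powr \<theta>\<^sub>5'
       + 0 * real (snd M) powr \<theta>\<^sub>4 < real (snd M) powr (\<theta>\<^sub>4 + \<epsilon>)"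
    "\<forall>\<^sub>F M in ?F. s * real (snd M) powr \<theta>\<^sub>4 + 2 * real (snd M) powr \<theta>\<^sub>5
       + L * n * real (snd M) powr ((\<theta> - \<delta>) * c) < real (snd M) powr ((\<theta> - \<delta> / 2) * c)"
    by (rule large(2)[OF powr_sum_dominated]; use \<theta>\<^sub>5 \<theta>\<^sub>5' \<theta>\<^sub>7 \<theta>\<^sub>7' assms(16) in linarith)+
  define ok :: "real \<Rightarrow> real \<Rightarrow> bool" where "ok = (\<lambda>m\<^sub>0 m\<^sub>1. m\<^sub>0 > 3 \<and>
      m\<^sub>0 powr \<kappa> \<le> s / 4 * m\<^sub>0 powr c \<and> L * n * m\<^sub>0 powr (\<theta> * c) \<le> s / 4 * m\<^sub>0 powr c \<and>
      2 * n * m\<^sub>0 powr \<iota> \<le> s / 4 * m\<^sub>0 powr c \<and> ln 2 + 2 * n * ln 3 \<le> s / 4 * m\<^sub>0 powr c \<and>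
      ln m\<^sub>1 > 0 \<and> ln m\<^sub>1 \<le> m\<^sub>0 powr \<iota> \<and>
      m\<^sub>0 \<le> m\<^sub>1 powr \<theta>\<^sub>4 \<and> m\<^sub>0\<^sup>2 \<le> m\<^sub>1 \<and> m\<^sub>0 powr c \<le> m\<^sub>1 powr (\<delta> / 2 * c) \<and>
      2 * m\<^sub>1 powr \<theta>\<^sub>4 \<le> m\<^sub>1 powr \<theta>\<^sub>3 \<and> 2 * m\<^sub>1 powr \<theta>\<^sub>3 \<le> m\<^sub>1 powr \<theta>\<^sub>2 \<and>
      m\<^sub>1 powr \<theta>\<^sub>5 \<le> s * (1 / 4) powr c * m\<^sub>1 powr (\<theta>\<^sub>3 * c) \<and>
      m\<^sub>1 powr \<theta>\<^sub>5' \<le> s * (1 / 4) powr c * m\<^sub>1 powr (\<theta>\<^sub>3 * c) \<and>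
      (1 + 2 * s) * m\<^sub>1 powr \<theta>\<^sub>4 + 3 * L * n * m\<^sub>1 powr \<theta>\<^sub>6 < m\<^sub>1 powr \<theta>\<^sub>5 \<and>
      (1 + 2 * s) * m\<^sub>1 powr \<theta>\<^sub>4 < m\<^sub>1 powr \<theta>\<^sub>5' \<and>
      (1 + s) * m\<^sub>1 powr \<theta>\<^sub>4 + m\<^sub>1 powr \<theta>\<^sub>5' < m\<^sub>1 powr (\<theta>\<^sub>4 + \<epsilon>) \<and>
      s * m\<^sub>1 powr \<theta>\<^sub>4 + 2 * m\<^sub>1 powr \<theta>\<^sub>5 + L * n * m\<^sub>1 powr ((\<theta> - \<delta>) * c)
        < m\<^sub>1 powr ((\<theta> - \<delta> / 2) * c))"
  have "\<forall>\<^sub>F M in ?F. ok (real (fst M)) (real (snd M))"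
    using ev1 ev2 ev3 ev4 ev5 ev6 ev7
    by eventually_elim (simp add: ok_def)
  from eventually_scale_filterD[OF this] obtain N where
    N: "\<And>M\<^sub>0 M\<^sub>1. M\<^sub>0 > N \<Longrightarrow> M\<^sub>1 > 0 \<Longrightarrow> ln (real M\<^sub>0) powr \<iota>' \<le> ln (ln (real M\<^sub>1)) \<Longrightarrow>
      ln (ln (real M\<^sub>1)) \<le> \<iota> * ln (real M\<^sub>0) \<Longrightarrow> ok (real M\<^sub>0) (real M\<^sub>1)"
    by auto
  show ?thesis
  proof (intro exI[of _ N] allI impI)
    fix M\<^sub>0 M\<^sub>1 :: nat and T :: "('b, 'd) site \<Rightarrow> ('b, 'd) site \<Rightarrow> complex"
      and Q :: "(int ^ 'd) set" and \<Omega> \<Omega>\<^sub>0 \<Omega>\<^sub>1 :: "('b, 'd) site set" and \<C> :: "('b, 'd) site set set"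
    assume M: "M\<^sub>0 > N" "M\<^sub>1 > 0" "ln (real M\<^sub>0) powr \<iota>' \<le> ln (ln (real M\<^sub>1))"
        "ln (ln (real M\<^sub>1)) \<le> \<iota> * ln (real M\<^sub>0)"
      and T: "\<forall>x x'. x \<noteq> x' \<longrightarrow> cmod (T x x') < exp (- L * alpha_norm \<alpha> (x - x'))"
      and Q: "cube_interval M\<^sub>1 Q" and \<Omega>: "\<Omega> = int_box M\<^sub>1 \<times> Q" and cover: "\<Omega> = \<Omega>\<^sub>0 \<union> \<Omega>\<^sub>1"
      and good: "\<forall>x\<in>\<Omega>\<^sub>0.
       invertible_on (window M\<^sub>0 x) T \<and>
       op_norm_on (window M\<^sub>0 x) (green T (window M\<^sub>0 x)) \<le> exp (real M\<^sub>0 powr \<kappa>) \<and>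
       (\<forall>\<eta>\<in>window M\<^sub>0 x. \<forall>\<eta>'\<in>window M\<^sub>0 x. max_norm (\<eta> - \<eta>') > real M\<^sub>0 powr \<theta> \<longrightarrow>
          cmod (green T (window M\<^sub>0 x) \<eta> \<eta>') < exp (- L * alpha_norm \<alpha> (\<eta> - \<eta>')))"
      and \<Omega>\<^sub>1: "\<Omega>\<^sub>1 = \<Union>\<C>" and diam: "\<forall>A\<in>\<C>. set_diam A < ereal (real M\<^sub>1 powr \<theta>\<^sub>1)"
      and sep: "\<forall>A\<in>\<C>. \<forall>B\<in>\<C>. A \<noteq> B \<longrightarrow> set_dist A B > ereal (real M\<^sub>1 powr \<theta>\<^sub>2)"
      and bad: "\<forall>A\<in>\<C>.
       invertible_on (nbhd_in \<Omega> (real M\<^sub>1 powr \<theta>\<^sub>3) A) T \<and>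
       op_norm_on (nbhd_in \<Omega> (real M\<^sub>1 powr \<theta>\<^sub>3) A) (green T (nbhd_in \<Omega> (real M\<^sub>1 powr \<theta>\<^sub>3) A))
         < exp (real M\<^sub>1 powr \<theta>\<^sub>4)"

    \<comment> \<open>Quantities at fixed scales\<close>
    define m\<^sub>0 m\<^sub>1 where "m\<^sub>0 = real M\<^sub>0" and "m\<^sub>1 = real M\<^sub>1"
    note N' = N[OF M, unfolded ok_def, folded m\<^sub>0_def m\<^sub>1_def]
    define K where "K = m\<^sub>0 powr \<kappa> + L * (n * m\<^sub>0 powr (\<theta> * c))"
    define \<Lambda> where "\<Lambda> = ln 2 + 2 * n * ln (3 * m\<^sub>1)"
    define R where "R = m\<^sub>1 powr \<theta>\<^sub>3"
    define a where "a = m\<^sub>1 powr (\<theta> - \<delta>)"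
    have m0: "m\<^sub>0 > 3" and ln_m1: "0 < ln m\<^sub>1" "ln m\<^sub>1 \<le> m\<^sub>0 powr \<iota>" using N' by simp_all
    have m1: "m\<^sub>1 > 1" using ln_m1(1) M(2) by (simp add: m\<^sub>1_def)
    have K0: "0 \<le> K" using assms(3) n by (simp add: K_def)
    have \<Lambda>0: "ln 2 \<le> \<Lambda>" using n m1 by (simp add: \<Lambda>_def)
    have "2 * n * ln m\<^sub>1 \<le> 2 * n * m\<^sub>0 powr \<iota>" using ln_m1 n by (intro mult_left_mono) auto
    moreover have "ln (3 * m\<^sub>1) = ln 3 + ln m\<^sub>1" using m1 by (simp add: ln_mult)
    ultimately have K\<Lambda>: "K + \<Lambda> \<le> s * m\<^sub>0 powr c"
      using N' m0 by (simp add: K_def \<Lambda>_def algebra_simps)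
    have "m\<^sub>0 powr c \<le> m\<^sub>0 powr 1" using m0 c by (intro powr_mono) auto
    moreover have m01: "m\<^sub>0 \<le> m\<^sub>1 powr \<theta>\<^sub>4" using N' m0 by simp
    ultimately have "m\<^sub>0 powr c \<le> m\<^sub>1 powr \<theta>\<^sub>4" using m0 by simp
    then have m0c: "s * m\<^sub>0 powr c \<le> s * m\<^sub>1 powr \<theta>\<^sub>4" using s by simp
    have scales: "m\<^sub>0 \<le> a" "R / 4 \<le> a" "m\<^sub>0 \<le> R / 2"
    proof -
      have "m\<^sub>1 powr \<theta>\<^sub>4 \<le> a" "R \<le> a"
        unfolding a_def R_def using m1 assms \<theta>\<delta>1 by (auto intro!: powr_mono)
      moreover have "R \<ge> 0" by (simp add: R_def)
      ultimately show "m\<^sub>0 \<le> a" "R / 4 \<le> a" using m01 by linarith+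
      have "2 * m\<^sub>1 powr \<theta>\<^sub>4 \<le> R" using N' by (simp add: R_def)
      then show "m\<^sub>0 \<le> R / 2" using m01 by linarith
    qed
    have R4: "(R / 4) powr c = (1 / 4) powr c * m\<^sub>1 powr (\<theta>\<^sub>3 * c)"
      by (simp add: R_def powr_divide powr_powr)

    \<comment> \<open>Geometry and size of the region\<close>
    obtain lo hi :: "'b + 'd \<Rightarrow> int" where box': "int_box M\<^sub>1 \<times> Q = site_box lo hi"
      and side: "\<And>k. hi k - lo k \<le> 2 * int M\<^sub>1" "\<And>k. int M\<^sub>1 - 1 \<le> hi k - lo k"
      by (rule region_is_site_box[OF Q]) blast
    have box: "\<Omega> = site_box lo hi" unfolding \<Omega> by (rule box')
    have fin: "finite \<Omega>" unfolding box by (rule site_box_finite_card[OF side(1)])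
    have "m\<^sub>0\<^sup>2 \<le> m\<^sub>1" using N' by simp
    moreover have "3 * m\<^sub>0 \<le> m\<^sub>0\<^sup>2" using m0 by (simp add: power2_eq_square)
    \<comment> \<open>The extra 1 allows for a cube with only \<open>M\<^sub>1\<close> integers in
      some direction.\<close>
    ultimately have "2 * real M\<^sub>0 + 1 \<le> real M\<^sub>1" using m0 unfolding m\<^sub>0_def m\<^sub>1_def by linarith
    then have side2: "2 * int M\<^sub>0 \<le> hi k - lo k" for k using side(2)[of k] by linarith
    have \<Lambda>: "2 * (real (card \<Omega>))\<^sup>2 \<le> exp \<Lambda>"
    proof -
      have "card \<Omega> \<le> (2 * M\<^sub>1 + 1) ^ (CARD('b) + CARD('d))"
        unfolding box by (rule site_box_finite_card[OF side(1)])
      then have "real (card \<Omega>) \<le> real ((2 * M\<^sub>1 + 1) ^ (CARD('b) + CARD('d)))" by (rule of_nat_mono)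
      also have "\<dots> = (2 * m\<^sub>1 + 1) ^ (CARD('b) + CARD('d))" by (simp add: m\<^sub>1_def add.commute)
      also have "\<dots> \<le> (3 * m\<^sub>1) ^ (CARD('b) + CARD('d))" using m1 by (intro power_mono) auto
      also have "\<dots> = (3 * m\<^sub>1) powr n" using m1 unfolding n_def by (subst powr_realpow) auto
      also have "\<dots> = exp (n * ln (3 * m\<^sub>1))" using m1 by (simp add: powr_def)
      finally have "(real (card \<Omega>))\<^sup>2 \<le> (exp (n * ln (3 * m\<^sub>1)))\<^sup>2" by (rule power_mono) simp
      also have "\<dots> = exp (2 * n * ln (3 * m\<^sub>1))" by (simp add: mult.assoc exp_double)
      finally show ?thesis by (simp add: \<Lambda>_def exp_add)
    qed

    \<comment> \<open>The scales are fixed, while the weight and its \<open>P\<close> and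
      \<open>B\<close> stay free, because the norm bound and the decay choose them
      differently.\<close>
    have est: "cmod (u x) \<le> 2 * exp (K + m\<^sub>1 powr \<theta>\<^sub>4 + P + B - \<psi> (x - y)) * cmod \<tau>"
      if \<psi>: "\<And>x y. \<psi> (x + y) \<le> \<psi> x + \<psi> y"
        "\<And>x. \<psi> x \<le> L * alpha_norm \<alpha> x - 2 * s * min (max_norm x) a powr c"
        "\<And>x. max_norm x \<le> m\<^sub>1 powr \<theta>\<^sub>1 + 2 * R \<Longrightarrow> \<psi> x \<le> P"
        and B: "0 \<le> B" "B \<le> s * (R / 4) powr c" "m\<^sub>1 powr \<theta>\<^sub>4 + P + \<Lambda> + s * m\<^sub>0 powr c \<le> B" and P: "0 \<le> P"
        and eq: "\<And>p. p \<in> \<Omega> \<Longrightarrow> (\<Sum>q\<in>\<Omega>. T p q * u q) = (if p = y then \<tau> else 0)" and x: "x \<in> \<Omega>"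
      for \<psi> P B u x y \<tau>
    proof (rule weighted_decay_estimate[where \<Omega> = \<Omega> and T = T and \<psi> = \<psi> and M = M\<^sub>0 and a = a and s = s
          and \<rho> = "m\<^sub>0 powr \<theta>" and \<kappa>\<^sub>0 = "m\<^sub>0 powr \<kappa>" and \<kappa>\<^sub>1 = "m\<^sub>1 powr \<theta>\<^sub>4" and D = "m\<^sub>1 powr \<theta>\<^sub>1",
          OF assms(1-3) _ T[rule_format] box fin side2 cover[unfolded \<Omega>\<^sub>1] _ _ _ _ _ _ _ \<psi> _ K0 \<Lambda>
            _ _ scales(2) _ B(1,2) _ P _ eq x])
      show "m\<^sub>0 powr \<kappa> + L * (real (CARD('b) + CARD('d)) * (m\<^sub>0 powr \<theta>) powr c) \<le> K"
        by (simp add: K_def n_def powr_powr)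
      show "max_norm (x - y) \<le> m\<^sub>1 powr \<theta>\<^sub>1" if "A \<in> \<C>" "x \<in> A" "y \<in> A" for A x y
      proof -
        have "ereal (max_norm (x - y)) < ereal (m\<^sub>1 powr \<theta>\<^sub>1)"
          unfolding m\<^sub>1_def using diam that(1)
          by (intro le_less_trans[OF max_norm_le_set_diam[OF that(2,3)]]) blast
        then show ?thesis by simp
      qed
      show "2 * R < max_norm (x - y)" if "A \<in> \<C>" "A' \<in> \<C>" "A \<noteq> A'" "x \<in> A" "y \<in> A'" for A A' x y
      proof -
        have "ereal (m\<^sub>1 powr \<theta>\<^sub>2) < ereal (max_norm (x - y))"
          unfolding m\<^sub>1_def using sep that(1-3)
          by (intro less_le_trans[OF _ set_dist_le_max_norm[OF that(4,5)]]) blast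
        moreover have "2 * R \<le> m\<^sub>1 powr \<theta>\<^sub>2" using N' by (simp add: R_def)
        ultimately show ?thesis by simp
      qed
    qed (use good bad s scales B K\<Lambda> in \<open>auto simp: m\<^sub>0_def m\<^sub>1_def R_def less_imp_le\<close>)

    \<comment> \<open>Invertibility and the norm bound\<close>
    have norm_est: "cmod (u x) \<le> 2 * exp (K + m\<^sub>1 powr \<theta>\<^sub>4 + m\<^sub>1 powr \<theta>\<^sub>5') * cmod \<tau>"
      if eq: "\<And>p. p \<in> \<Omega> \<Longrightarrow> (\<Sum>q\<in>\<Omega>. T p q * u q) = (if p = y then \<tau> else 0)" and x: "x \<in> \<Omega>" for u x y \<tau>
    proof -
      \<comment> \<open>The zero weight has the required gain because \<open>2 powr c > 1\<close>
        gives \<open>2 * s \<le> L\<close>.\<close>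
      have gain: "0 \<le> L * alpha_norm \<alpha> z - 2 * s * min (max_norm z) a powr c" for z :: "('b, 'd) site"
      proof -
        have "2 * s \<le> L * 1"
          unfolding two_s using assms(3) two_powr_bounds[OF c] by (intro mult_left_mono) auto
        then have "2 * s * min (max_norm z) a powr c \<le> L * max_norm z powr c"
          using s assms(3) c by (intro mult_mono powr_mono2) (auto simp: a_def)
        also have "\<dots> \<le> L * alpha_norm \<alpha> z"
          using alpha_norm_ge[of \<alpha> z] assms(1-3) by (intro mult_left_mono) auto
        finally show ?thesis by simp
      qed
      have "cmod (u x) \<le> 2 * exp (K + m\<^sub>1 powr \<theta>\<^sub>4 + 0 + m\<^sub>1 powr \<theta>\<^sub>5' - 0) * cmod \<tau>"
      proof (rule est[where \<psi> = "\<lambda>_. 0" and P = 0, OF _ gain _ _ _ _ _ eq x])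
        show "m\<^sub>1 powr \<theta>\<^sub>5' \<le> s * (R / 4) powr c" using N' by (simp add: R4 mult.assoc)
        have "(1 + 2 * s) * m\<^sub>1 powr \<theta>\<^sub>4 < m\<^sub>1 powr \<theta>\<^sub>5'" using N' by simp
        then show "m\<^sub>1 powr \<theta>\<^sub>4 + 0 + \<Lambda> + s * m\<^sub>0 powr c \<le> m\<^sub>1 powr \<theta>\<^sub>5'"
          using m0c K\<Lambda> K0 by (simp add: algebra_simps)
      qed auto
      then show ?thesis by simp
    qed

    have inv: "invertible_on \<Omega> T"
    proof (rule invertible_on_if_trivial_kernel[OF fin])
      fix u x assume "\<And>x. x \<in> \<Omega> \<Longrightarrow> (\<Sum>y\<in>\<Omega>. T x y * u y) = 0" "x \<in> \<Omega>"
      \<comment> \<open>With \<open>\<tau> = 0\<close> the position of the source is arbitrary, and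
        \<open>x\<close> is taken.\<close>
      then show "u x = 0" using norm_est[of u x 0 x] by simp
    qed
    define G where "G = green T \<Omega>"
    have G: "(\<Sum>q\<in>\<Omega>. T p q * G q y) = (if p = y then 1 else 0)" if "p \<in> \<Omega>" "y \<in> \<Omega>" for p y
      using inverse_on_green[OF fin inv] that by (simp add: inverse_on_def G_def)

    have "op_norm_on \<Omega> G \<le> (real (card \<Omega>))\<^sup>2 * (2 * exp (K + m\<^sub>1 powr \<theta>\<^sub>4 + m\<^sub>1 powr \<theta>\<^sub>5'))"
    proof (rule op_norm_on_le_if_entries_le[OF fin])
      fix x y assume "x \<in> \<Omega>" "y \<in> \<Omega>"
      then show "cmod (G x y) \<le> 2 * exp (K + m\<^sub>1 powr \<theta>\<^sub>4 + m\<^sub>1 powr \<theta>\<^sub>5')"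
        using norm_est[of "\<lambda>z. G z y" y 1 x] G by simp
    qed
    also have "\<dots> \<le> exp \<Lambda> * exp (K + m\<^sub>1 powr \<theta>\<^sub>4 + m\<^sub>1 powr \<theta>\<^sub>5')"
      using mult_right_mono[OF \<Lambda>, of "exp (K + m\<^sub>1 powr \<theta>\<^sub>4 + m\<^sub>1 powr \<theta>\<^sub>5')"] by (simp add: mult_ac)
    also have "\<dots> = exp (K + \<Lambda> + m\<^sub>1 powr \<theta>\<^sub>4 + m\<^sub>1 powr \<theta>\<^sub>5')" by (simp add: mult_ac flip: exp_add)
    also have "\<dots> < exp (m\<^sub>1 powr (\<theta>\<^sub>4 + \<epsilon>))"
    proof -
      have "(1 + s) * m\<^sub>1 powr \<theta>\<^sub>4 + m\<^sub>1 powr \<theta>\<^sub>5' < m\<^sub>1 powr (\<theta>\<^sub>4 + \<epsilon>)" using N' by simp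
      then show ?thesis using K\<Lambda> m0c by (simp add: algebra_simps)
    qed
    finally have norm: "op_norm_on \<Omega> G < exp (m\<^sub>1 powr (\<theta>\<^sub>4 + \<epsilon>))" .

    \<comment> \<open>Off-diagonal decay\<close>
    have decay: "cmod (G x y) < exp (- (L - 2 * m\<^sub>0 powr (max \<iota> (max \<kappa> (\<theta> * c)) - c)) * alpha_norm \<alpha> (x - y))"
      if x: "x \<in> \<Omega>" and y: "y \<in> \<Omega>" and far: "max_norm (x - y) > m\<^sub>1 powr \<theta>" for x y
    proof -
      define \<psi> :: "('b, 'd) site \<Rightarrow> real" where "\<psi> = (\<lambda>z. L * shifted_norm c a z)"
      define P where "P = 3 * L * n * m\<^sub>1 powr \<theta>\<^sub>6"
      have a: "a > 0" using m1 by (simp add: a_def)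
      have main: "(1 + 2 * s) * m\<^sub>1 powr \<theta>\<^sub>4 + P < m\<^sub>1 powr \<theta>\<^sub>5" using N' by (simp add: P_def)
      have P0: "0 \<le> P" using assms(3) n by (simp add: P_def)
      have bound: "cmod (G x y) \<le> 2 * exp (K + m\<^sub>1 powr \<theta>\<^sub>4 + P + m\<^sub>1 powr \<theta>\<^sub>5 - \<psi> (x - y)) * cmod 1"
      proof (rule est[where u = "\<lambda>z. G z y", OF _ _ _ _ _ _ P0 G[OF _ y] x])
        show "\<psi> (z + w) \<le> \<psi> z + \<psi> w" for z w
          using mult_left_mono[OF shifted_norm_triangle[OF c a, of z w], of L] assms(3)
          by (simp add: \<psi>_def distrib_left)
        show "\<psi> z \<le> L * alpha_norm \<alpha> z - 2 * s * min (max_norm z) a powr c" for z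
          using mult_left_mono[OF shifted_norm_le_alpha_norm[OF assms(1) a, of z], of L] assms(3)
          unfolding \<psi>_def two_s assms(2)
          by (simp add: mult.assoc right_diff_distrib[of L "alpha_norm \<alpha> z"])
        show "\<psi> z \<le> P" if z: "max_norm z \<le> m\<^sub>1 powr \<theta>\<^sub>1 + 2 * R" for z
        proof -
          have "R \<le> m\<^sub>1 powr \<theta>\<^sub>1" unfolding R_def using m1 assms(9,10) by (intro powr_mono) auto
          then have "max_norm z \<le> 3 * m\<^sub>1 powr \<theta>\<^sub>1" using z by linarith
          from shifted_norm_le[OF c a this]
          have "\<psi> z \<le> L * (n * (a powr (c - 1) * (3 * m\<^sub>1 powr \<theta>\<^sub>1)))"
            unfolding \<psi>_def n_def using assms(3) by (intro mult_left_mono) auto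
          also have "\<dots> = P"
            by (simp add: P_def \<theta>\<^sub>6_def a_def powr_powr powr_add)
          finally show ?thesis .
        qed
        show "m\<^sub>1 powr \<theta>\<^sub>5 \<le> s * (R / 4) powr c" using N' by (simp add: R4 mult.assoc)
        show "m\<^sub>1 powr \<theta>\<^sub>4 + P + \<Lambda> + s * m\<^sub>0 powr c \<le> m\<^sub>1 powr \<theta>\<^sub>5"
          using main m0c K\<Lambda> K0 by (simp add: algebra_simps)
      qed auto
      define X where "X = alpha_norm \<alpha> (x - y)"
      have "alpha_norm \<alpha> (x - y) - n * a powr c \<le> shifted_norm c a (x - y)"
        using shifted_norm_ge[of \<alpha> a "x - y"] assms(1,2) a by (simp add: n_def)
      then have "L * (X - n * a powr c) \<le> \<psi> (x - y)"
        unfolding \<psi>_def X_def using assms(3) by (intro mult_left_mono) auto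
      moreover have "a powr c = m\<^sub>1 powr ((\<theta> - \<delta>) * c)" by (simp add: a_def powr_powr)
      ultimately have \<psi>: "L * X - L * n * m\<^sub>1 powr ((\<theta> - \<delta>) * c) \<le> \<psi> (x - y)" by (simp add: algebra_simps)
      have "m\<^sub>1 powr (\<theta> * c) = (m\<^sub>1 powr \<theta>) powr c" by (simp add: powr_powr)
      also have "\<dots> \<le> max_norm (x - y) powr c" using far c by (intro powr_mono2) auto
      also have "\<dots> \<le> X" using alpha_norm_ge[of \<alpha> "x - y"] assms(1,2) by (simp add: X_def)
      finally have X: "m\<^sub>1 powr (\<theta> * c) \<le> X" .
      \<comment> \<open>All losses stay below this power. One half of \<open>\<delta>\<close>
        separates it from the shift cost \<open>a powr c\<close>, the other from
        \<open>m\<^sub>1 powr (\<theta> * c) \<le> X\<close>; the latter gap exceeds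
        \<open>m\<^sub>0 powr c\<close>, so the losses are a small fraction of
        \<open>X\<close>.\<close>
      have "m\<^sub>1 powr ((\<theta> - \<delta> / 2) * c) = m\<^sub>1 powr (\<theta> * c) / m\<^sub>1 powr (\<delta> / 2 * c)"
        by (simp add: algebra_simps flip: powr_diff)
      also have "\<dots> \<le> m\<^sub>1 powr (\<theta> * c) / m\<^sub>0 powr c"
        using N' m0 m1 by (intro divide_left_mono) auto
      also have "\<dots> \<le> X / m\<^sub>0 powr c" using X by (intro divide_right_mono) auto
      also have "\<dots> = m\<^sub>0 powr (- c) * X" by (simp add: powr_minus field_simps)
      also have "\<dots> \<le> m\<^sub>0 powr (max \<iota> (max \<kappa> (\<theta> * c)) - c) * X"
      proof (intro mult_right_mono powr_mono)
        have "0 < \<theta> * c" using assms c by (intro mult_pos_pos) linarith+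
        then show "- c \<le> max \<iota> (max \<kappa> (\<theta> * c)) - c" by linarith
      qed (use m0 in \<open>auto simp: X_def\<close>)
      finally have rate: "m\<^sub>1 powr ((\<theta> - \<delta> / 2) * c) \<le> m\<^sub>0 powr (max \<iota> (max \<kappa> (\<theta> * c)) - c) * X" .
      have "s * m\<^sub>1 powr \<theta>\<^sub>4 + 2 * m\<^sub>1 powr \<theta>\<^sub>5 + L * n * m\<^sub>1 powr ((\<theta> - \<delta>) * c) < m\<^sub>1 powr ((\<theta> - \<delta> / 2) * c)"
        using N' by simp
      moreover have "m\<^sub>1 powr \<theta>\<^sub>4 + P \<le> m\<^sub>1 powr \<theta>\<^sub>5"
      proof -
        have "0 \<le> s * m\<^sub>1 powr \<theta>\<^sub>4" using s by simp
        then show ?thesis using main by (simp add: algebra_simps)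
      qed
      moreover have "0 \<le> m\<^sub>1 powr ((\<theta> - \<delta> / 2) * c)" by simp
      \<comment> \<open>\<open>ln 2 + K\<close> is absorbed by
        \<open>s * m\<^sub>1 powr \<theta>\<^sub>4\<close>, and
        \<open>m\<^sub>1 powr \<theta>\<^sub>4 + P\<close> by one of the two terms
        \<open>m\<^sub>1 powr \<theta>\<^sub>5\<close>.\<close>
      ultimately have "ln 2 + (K + m\<^sub>1 powr \<theta>\<^sub>4 + P + m\<^sub>1 powr \<theta>\<^sub>5 - \<psi> (x - y))
          < 2 * (m\<^sub>0 powr (max \<iota> (max \<kappa> (\<theta> * c)) - c) * X) - L * X"
        using \<psi> rate K\<Lambda> \<Lambda>0 m0c by linarith
      also have "\<dots> = - (L - 2 * m\<^sub>0 powr (max \<iota> (max \<kappa> (\<theta> * c)) - c)) * X"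
        by (simp add: algebra_simps)
      finally have "exp (ln 2 + (K + m\<^sub>1 powr \<theta>\<^sub>4 + P + m\<^sub>1 powr \<theta>\<^sub>5 - \<psi> (x - y)))
          < exp (- (L - 2 * m\<^sub>0 powr (max \<iota> (max \<kappa> (\<theta> * c)) - c)) * X)" by simp
      moreover have "exp (ln 2 + (K + m\<^sub>1 powr \<theta>\<^sub>4 + P + m\<^sub>1 powr \<theta>\<^sub>5 - \<psi> (x - y)))
          = 2 * exp (K + m\<^sub>1 powr \<theta>\<^sub>4 + P + m\<^sub>1 powr \<theta>\<^sub>5 - \<psi> (x - y)) * cmod 1"
        by (simp add: exp_add[of "ln 2"])
      ultimately show ?thesis using bound by (simp only: X_def)
    qed
    show "invertible_on \<Omega> T \<and> op_norm_on \<Omega> (green T \<Omega>) < exp (real M\<^sub>1 powr (\<theta>\<^sub>4 + \<epsilon>)) \<and>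
      (\<forall>x\<in>\<Omega>. \<forall>y\<in>\<Omega>. max_norm (x - y) > real M\<^sub>1 powr \<theta> \<longrightarrow> cmod (green T \<Omega> x y)
         < exp (- (L - 2 * real M\<^sub>0 powr (max \<iota> (max \<kappa> (\<theta> * c)) - c)) * alpha_norm \<alpha> (x - y)))"
      using inv norm decay unfolding G_def m\<^sub>0_def m\<^sub>1_def by blast
  qed
qed

end
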